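(* Let $R$ be a commutative ring such that every RD-essential extension of $R$-modules is essential. Then for every maximal ideal $P$ of $R$, the localization $R_P$ is a pure-semisimple ring.
   Context: A submodule is RD-pure if the inclusion remains injective after tensoring with every module $R/rR$, $r\in R$. An extension $A\subseteq B$ is RD-essential if $A$ is RD-pure in $B$ and for every submodule $K$ of $B$, either $K\cap A\neq0$ or $(A+K)/K$ is not RD-pure in $B/K$. A ring is pure-semisimple if every module over it is pure-injective (injective relative to exact sequences remaining exact under tensoring with every module).
   Formalization: In the definition of RD-essential, the condition is required only for every nonzero submodule K of B; with K = 0 allowed, no extension would be RD-essential and the statement would fail (e.g. for the ring of integers). *)

theory Defs
  imports "HOL-Algebra.Module" "HOL-Algebra.QuotRing"
begin

definition module_hom ::
  "('s,'c) ring_scheme \<Rightarrow> ('s,'a) module \<Rightarrow> ('s,'b) module \<Rightarrow> ('a \<Rightarrow> 'b) set" where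
  "module_hom S M N = {f. f \<in> carrier M \<rightarrow> carrier N
      \<and> (\<forall>x\<in>carrier M. \<forall>y\<in>carrier M. f (x \<oplus>\<^bsub>M\<^esub> y) = f x \<oplus>\<^bsub>N\<^esub> f y)
      \<and> (\<forall>c\<in>carrier S. \<forall>x\<in>carrier M. f (c \<odot>\<^bsub>M\<^esub> x) = c \<odot>\<^bsub>N\<^esub> f x)}"

section \<open>Tensor products, realised as free modules modulo bilinearity relations\<close>

text \<open>Elements of the free S-module on X \<times> Y: finitely supported S-valued functions
  whose support lies in X \<times> Y.\<close>
definition fsupp :: "('s,'c) ring_scheme \<Rightarrow> 'b set \<Rightarrow> 'n set \<Rightarrow> ('b \<times> 'n \<Rightarrow> 's) set" where
  "fsupp S X Y = {\<phi>. (\<forall>p. \<phi> p \<in> carrier S) \<and> finite {p. \<phi> p \<noteq> \<zero>\<^bsub>S\<^esub>}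
                      \<and> {p. \<phi> p \<noteq> \<zero>\<^bsub>S\<^esub>} \<subseteq> X \<times> Y}"

definition fdelta :: "('s,'c) ring_scheme \<Rightarrow> 'p \<Rightarrow> 'p \<Rightarrow> 's" where
  "fdelta S p = (\<lambda>q. if q = p then \<one>\<^bsub>S\<^esub> else \<zero>\<^bsub>S\<^esub>)"

definition fadd :: "('s,'c) ring_scheme \<Rightarrow> ('p \<Rightarrow> 's) \<Rightarrow> ('p \<Rightarrow> 's) \<Rightarrow> 'p \<Rightarrow> 's" where
  "fadd S \<phi> \<psi> = (\<lambda>p. \<phi> p \<oplus>\<^bsub>S\<^esub> \<psi> p)"

definition fminus :: "('s,'c) ring_scheme \<Rightarrow> ('p \<Rightarrow> 's) \<Rightarrow> ('p \<Rightarrow> 's) \<Rightarrow> 'p \<Rightarrow> 's" where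
  "fminus S \<phi> \<psi> = (\<lambda>p. \<phi> p \<ominus>\<^bsub>S\<^esub> \<psi> p)"

definition fscale :: "('s,'c) ring_scheme \<Rightarrow> 's \<Rightarrow> ('p \<Rightarrow> 's) \<Rightarrow> 'p \<Rightarrow> 's" where
  "fscale S c \<phi> = (\<lambda>p. c \<otimes>\<^bsub>S\<^esub> \<phi> p)"

inductive_set fspan :: "('s,'c) ring_scheme \<Rightarrow> ('p \<Rightarrow> 's) set \<Rightarrow> ('p \<Rightarrow> 's) set"
  for S G where
  fspan_zero: "(\<lambda>_. \<zero>\<^bsub>S\<^esub>) \<in> fspan S G"
| fspan_step: "\<lbrakk>g \<in> G; c \<in> carrier S; v \<in> fspan S G\<rbrakk> \<Longrightarrow> fadd S (fscale S c g) v \<in> fspan S G"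

definition tensor_rels ::
  "('s,'c) ring_scheme \<Rightarrow> ('s,'b) module \<Rightarrow> ('s,'n) module \<Rightarrow> 'b set \<Rightarrow> ('b \<times> 'n \<Rightarrow> 's) set" where
  "tensor_rels S M N X =
     {fminus S (fdelta S (x \<oplus>\<^bsub>M\<^esub> x', n)) (fadd S (fdelta S (x, n)) (fdelta S (x', n)))
        | x x' n. x \<in> X \<and> x' \<in> X \<and> n \<in> carrier N}
   \<union> {fminus S (fdelta S (x, n \<oplus>\<^bsub>N\<^esub> n')) (fadd S (fdelta S (x, n)) (fdelta S (x, n')))
        | x n n'. x \<in> X \<and> n \<in> carrier N \<and> n' \<in> carrier N}
   \<union> {fminus S (fdelta S (c \<odot>\<^bsub>M\<^esub> x, n)) (fscale S c (fdelta S (x, n)))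
        | c x n. c \<in> carrier S \<and> x \<in> X \<and> n \<in> carrier N}
   \<union> {fminus S (fdelta S (x, c \<odot>\<^bsub>N\<^esub> n)) (fscale S c (fdelta S (x, n)))
        | c x n. c \<in> carrier S \<and> x \<in> X \<and> n \<in> carrier N}"

text \<open>The map A \<otimes>_S N \<rightarrow> B \<otimes>_S N induced by the inclusion of a submodule A of B
  is injective (its kernel is trivial).  An element of A \<otimes> N is represented by
  some \<phi> in the free module on A \<times> N; it is zero in A \<otimes> N iff \<phi> lies in the span of
  the relations over A, and its image is zero in B \<otimes> N iff \<phi> lies in the span of
  the relations over B.\<close>
definition tensor_inj ::
  "('s,'c) ring_scheme \<Rightarrow> ('s,'n) module \<Rightarrow> 'b set \<Rightarrow> ('s,'b) module \<Rightarrow> bool" where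
  "tensor_inj S N A B \<longleftrightarrow>
     (\<forall>\<phi> \<in> fsupp S A (carrier N).
        \<phi> \<in> fspan S (tensor_rels S B N (carrier B)) \<longrightarrow> \<phi> \<in> fspan S (tensor_rels S B N A))"

definition quot_module :: "('s,'b) module \<Rightarrow> 'b set \<Rightarrow> ('s, 'b set) module" where
  "quot_module M K =
     \<lparr>carrier = a_rcosets\<^bsub>M\<^esub> K,
      mult = (\<lambda>_ _. K), one = K,
      zero = K,
      add = set_add M,
      smult = (\<lambda>c X. \<Union>x\<in>X. K +>\<^bsub>M\<^esub> (c \<odot>\<^bsub>M\<^esub> x))\<rparr>"

definition cyclic_mod :: "('r,'c) ring_scheme \<Rightarrow> 'r \<Rightarrow> ('r, 'r set) module" where
  "cyclic_mod R r =
     \<lparr>carrier = carrier (R Quot (PIdl\<^bsub>R\<^esub> r)),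
      mult = mult (R Quot (PIdl\<^bsub>R\<^esub> r)), one = one (R Quot (PIdl\<^bsub>R\<^esub> r)),
      zero = zero (R Quot (PIdl\<^bsub>R\<^esub> r)),
      add = add (R Quot (PIdl\<^bsub>R\<^esub> r)),
      smult = (\<lambda>a X. ((PIdl\<^bsub>R\<^esub> r) +>\<^bsub>R\<^esub> a) \<otimes>\<^bsub>R Quot (PIdl\<^bsub>R\<^esub> r)\<^esub> X)\<rparr>"

definition RD_pure :: "('r,'c) ring_scheme \<Rightarrow> 'b set \<Rightarrow> ('r,'b) module \<Rightarrow> bool" where
  "RD_pure R A B \<longleftrightarrow> (\<forall>r \<in> carrier R. tensor_inj R (cyclic_mod R r) A B)"

definition RD_essential :: "('r,'c) ring_scheme \<Rightarrow> 'b set \<Rightarrow> ('r,'b) module \<Rightarrow> bool" where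
  "RD_essential R A B \<longleftrightarrow> RD_pure R A B \<and>
     (\<forall>K. submodule K R B \<and> K \<noteq> {\<zero>\<^bsub>B\<^esub>} \<longrightarrow>
          K \<inter> A \<noteq> {\<zero>\<^bsub>B\<^esub>} \<or>
          \<not> RD_pure R ((\<lambda>a. K +>\<^bsub>B\<^esub> a) ` A) (quot_module B K))"

definition essential :: "('r,'c) ring_scheme \<Rightarrow> 'b set \<Rightarrow> ('r,'b) module \<Rightarrow> bool" where
  "essential R A B \<longleftrightarrow>
     (\<forall>K. submodule K R B \<and> K \<noteq> {\<zero>\<^bsub>B\<^esub>} \<longrightarrow> K \<inter> A \<noteq> {\<zero>\<^bsub>B\<^esub>})"

definition pure_sub :: "('s,'c) ring_scheme \<Rightarrow> 'b set \<Rightarrow> ('s,'b) module \<Rightarrow> bool" where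
  "pure_sub S A B \<longleftrightarrow>
     (\<forall>N :: ('s, 's list set) module. module S N \<longrightarrow> tensor_inj S N A B)"

definition pure_mono ::
  "('s,'c) ring_scheme \<Rightarrow> ('s,'a) module \<Rightarrow> ('s,'b) module \<Rightarrow> ('a \<Rightarrow> 'b) \<Rightarrow> bool" where
  "pure_mono S A B f \<longleftrightarrow> f \<in> module_hom S A B \<and> inj_on f (carrier A)
      \<and> pure_sub S (f ` carrier A) B"

definition pure_injective_along ::
  "('s,'c) ring_scheme \<Rightarrow> ('s,'e) module \<Rightarrow> ('s,'a) module \<Rightarrow> ('s,'b) module \<Rightarrow> ('a \<Rightarrow> 'b) \<Rightarrow> bool" where
  "pure_injective_along S E A B f \<longleftrightarrow>
     (module S E \<and> module S A \<and> module S B \<and> pure_mono S A B f \<longrightarrow>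
       (\<forall>g \<in> module_hom S A E. \<exists>h \<in> module_hom S B E. \<forall>a \<in> carrier A. h (f a) = g a))"

definition loc_eq :: "('r,'c) ring_scheme \<Rightarrow> 'r set \<Rightarrow> (('r \<times> 'r) \<times> ('r \<times> 'r)) set" where
  "loc_eq R S = {((a, s), (b, t)). a \<in> carrier R \<and> b \<in> carrier R \<and> s \<in> S \<and> t \<in> S \<and>
                   (\<exists>u \<in> S. u \<otimes>\<^bsub>R\<^esub> (a \<otimes>\<^bsub>R\<^esub> t \<ominus>\<^bsub>R\<^esub> b \<otimes>\<^bsub>R\<^esub> s) = \<zero>\<^bsub>R\<^esub>)}"

definition frac :: "('r,'c) ring_scheme \<Rightarrow> 'r set \<Rightarrow> 'r \<Rightarrow> 'r \<Rightarrow> ('r \<times> 'r) set" where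
  "frac R S a s = loc_eq R S `` {(a, s)}"

definition localization :: "('r,'c) ring_scheme \<Rightarrow> 'r set \<Rightarrow> ('r \<times> 'r) set ring" where
  "localization R S =
     \<lparr>carrier = {frac R S a s | a s. a \<in> carrier R \<and> s \<in> S},
      mult = (\<lambda>X Y. case (SOME p. p \<in> X, SOME q. q \<in> Y) of
                ((a, s), (b, t)) \<Rightarrow> frac R S (a \<otimes>\<^bsub>R\<^esub> b) (s \<otimes>\<^bsub>R\<^esub> t)),
      one = frac R S \<one>\<^bsub>R\<^esub> \<one>\<^bsub>R\<^esub>,
      zero = frac R S \<zero>\<^bsub>R\<^esub> \<one>\<^bsub>R\<^esub>,
      add = (\<lambda>X Y. case (SOME p. p \<in> X, SOME q. q \<in> Y) of
                ((a, s), (b, t)) \<Rightarrow> frac R S (a \<otimes>\<^bsub>R\<^esub> t \<oplus>\<^bsub>R\<^esub> b \<otimes>\<^bsub>R\<^esub> s) (s \<otimes>\<^bsub>R\<^esub> t))\<rparr>"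

definition localize_at :: "('r,'c) ring_scheme \<Rightarrow> 'r set \<Rightarrow> ('r \<times> 'r) set ring" where
  "localize_at R P = localization R (carrier R - P)"

end

theory Submission
  imports Defs
begin

text \<open>
  RD-purity of A in B means \<open>rB \<inter> A = rA\<close> for all r.  By Zorn's lemma every RD-pure extension has a
  quotient that is an RD-essential extension of the same module, which by hypothesis is essential.
  Applied to a direct sum inside a direct product, and to a cyclic module inside \<open>R \<oplus> R\<close>, this shows
  that P is locally T-nilpotent and that any two elements of P locally have a common divisor in P;
  together these make the maximal ideal of \<open>R\<^sub>P\<close> principal, generated by a nilpotent element.  Over
  such a ring an essential RD-pure extension is trivial, so every RD-pure extension splits, and
  pushing out along a given homomorphism gives pure-injectivity.
\<close>

section \<open>Submodules, homomorphisms and quotients\<close>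

lemma (in abelian_group) minus_zero_right [simp]: "x \<in> carrier G \<Longrightarrow> x \<ominus> \<zero> = x"
  using minus_equality[of \<zero> \<zero>] by (simp add: minus_eq)

context module
begin

lemma smult_l_diff:
  "\<lbrakk>a \<in> carrier R; b \<in> carrier R; x \<in> carrier M\<rbrakk> \<Longrightarrow> (a \<ominus> b) \<odot>\<^bsub>M\<^esub> x = a \<odot>\<^bsub>M\<^esub> x \<ominus>\<^bsub>M\<^esub> b \<odot>\<^bsub>M\<^esub> x"
  by (simp add: R.minus_eq M.minus_eq smult_l_distr smult_l_minus)

lemma smult_r_diff:
  "\<lbrakk>a \<in> carrier R; x \<in> carrier M; y \<in> carrier M\<rbrakk> \<Longrightarrow> a \<odot>\<^bsub>M\<^esub> (x \<ominus>\<^bsub>M\<^esub> y) = a \<odot>\<^bsub>M\<^esub> x \<ominus>\<^bsub>M\<^esub> a \<odot>\<^bsub>M\<^esub> y"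
  by (simp add: M.minus_eq smult_r_distr smult_r_minus)

lemma submodule_closed: "\<lbrakk>submodule K R M; x \<in> K\<rbrakk> \<Longrightarrow> x \<in> carrier M"
  using submoduleE(1) by blast

lemma submodule_imp_abelian_subgroup: "submodule K R M \<Longrightarrow> abelian_subgroup K M"
  by (simp add: M.abelian_group_axioms abelian_subgroupI3 additive_subgroup.intro
      submodule.axioms(1))

lemma submodule_zero_closed: "submodule K R M \<Longrightarrow> \<zero>\<^bsub>M\<^esub> \<in> K"
  by (meson abelian_subgroup.axioms(1) additive_subgroup.zero_closed submodule_imp_abelian_subgroup)

lemma submodule_minus_closed: "\<lbrakk>submodule K R M; x \<in> K; y \<in> K\<rbrakk> \<Longrightarrow> x \<ominus>\<^bsub>M\<^esub> y \<in> K"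
  by (simp add: M.minus_eq submoduleE)

lemma submodule_minus_commute:
  assumes "submodule K R M" "x \<in> carrier M" "y \<in> carrier M" "x \<ominus>\<^bsub>M\<^esub> y \<in> K"
  shows "y \<ominus>\<^bsub>M\<^esub> x \<in> K"
  using submoduleE(3)[OF assms(1,4)] assms(2,3) by (simp add: M.minus_eq M.minus_add M.a_comm)

lemma submodule_minus_mem_iff:
  assumes K: "submodule K R M" and x: "x \<in> carrier M" and y: "y \<in> carrier M" and "x \<ominus>\<^bsub>M\<^esub> y \<in> K"
  shows "x \<in> K \<longleftrightarrow> y \<in> K"
proof -
  have mem: "u \<in> K" if "u \<in> carrier M" "v \<in> K" "u \<ominus>\<^bsub>M\<^esub> v \<in> K" for u v
  proof -
    have "v \<in> carrier M" using submodule_closed[OF K that(2)] .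
    then have "u = (u \<ominus>\<^bsub>M\<^esub> v) \<oplus>\<^bsub>M\<^esub> v" using that(1) by (simp add: M.minus_eq M.a_assoc M.l_neg)
    then show ?thesis using submoduleE(5)[OF K that(3,2)] by simp
  qed
  show ?thesis
    using mem[OF x _ assms(4)] mem[OF y _ submodule_minus_commute[OF K x y assms(4)]] by blast
qed

lemma submodule_smult_image:
  assumes X: "submodule X R M" and r: "r \<in> carrier R"
  shows "submodule ((\<lambda>x. r \<odot>\<^bsub>M\<^esub> x) ` X) R M"
proof (rule submoduleI)
  note XE = submoduleE[OF X] and XM = submodule_closed[OF X]
  show "(\<lambda>x. r \<odot>\<^bsub>M\<^esub> x) ` X \<subseteq> carrier M" using XM r by auto
  show "\<zero>\<^bsub>M\<^esub> \<in> (\<lambda>x. r \<odot>\<^bsub>M\<^esub> x) ` X"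
    using r submodule_zero_closed[OF X] by (intro image_eqI[of _ _ "\<zero>\<^bsub>M\<^esub>"]) auto
  show "\<ominus>\<^bsub>M\<^esub> a \<in> (\<lambda>x. r \<odot>\<^bsub>M\<^esub> x) ` X" if "a \<in> (\<lambda>x. r \<odot>\<^bsub>M\<^esub> x) ` X" for a
    using that r XE(3) XM by (auto simp flip: smult_r_minus)
  show "a \<oplus>\<^bsub>M\<^esub> b \<in> (\<lambda>x. r \<odot>\<^bsub>M\<^esub> x) ` X"
    if "a \<in> (\<lambda>x. r \<odot>\<^bsub>M\<^esub> x) ` X" "b \<in> (\<lambda>x. r \<odot>\<^bsub>M\<^esub> x) ` X" for a b
    using that r XE(5) XM by (auto simp flip: smult_r_distr)
  show "c \<odot>\<^bsub>M\<^esub> a \<in> (\<lambda>x. r \<odot>\<^bsub>M\<^esub> x) ` X" if c: "c \<in> carrier R" and a: "a \<in> (\<lambda>x. r \<odot>\<^bsub>M\<^esub> x) ` X" for c a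
  proof -
    obtain x where x: "x \<in> X" "a = r \<odot>\<^bsub>M\<^esub> x" using a by blast
    then have "c \<odot>\<^bsub>M\<^esub> a = r \<odot>\<^bsub>M\<^esub> (c \<odot>\<^bsub>M\<^esub> x)"
      using r c XM[OF x(1)] by (simp add: R.m_comm flip: smult_assoc1)
    then show ?thesis using XE(4)[OF c x(1)] by blast
  qed
qed

lemma submodule_ideal_smult:
  assumes I: "ideal I R" and z: "z \<in> carrier M"
  shows "submodule ((\<lambda>c. c \<odot>\<^bsub>M\<^esub> z) ` I) R M"
proof (rule submoduleI)
  interpret I: ideal I R by fact
  let ?N = "(\<lambda>c. c \<odot>\<^bsub>M\<^esub> z) ` I"
  show "?N \<subseteq> carrier M" using z by auto
  show "\<zero>\<^bsub>M\<^esub> \<in> ?N" using z I.zero_closed by (intro image_eqI[of _ _ "\<zero>"]) auto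
  show "\<ominus>\<^bsub>M\<^esub> a \<in> ?N" if "a \<in> ?N" for a
    using that z by (auto simp flip: smult_l_minus)
  show "a \<oplus>\<^bsub>M\<^esub> b \<in> ?N" if "a \<in> ?N" "b \<in> ?N" for a b
    using that z I.a_closed by (auto simp flip: smult_l_distr)
  show "c \<odot>\<^bsub>M\<^esub> a \<in> ?N" if "c \<in> carrier R" "a \<in> ?N" for a c
    using that z I.I_l_closed by (auto simp flip: smult_assoc1)
qed

lemma submodule_Union_chain:
  assumes "C \<noteq> {}" and sub: "\<And>X. X \<in> C \<Longrightarrow> submodule X R M"
    and chain: "\<And>X Y. \<lbrakk>X \<in> C; Y \<in> C\<rbrakk> \<Longrightarrow> X \<subseteq> Y \<or> Y \<subseteq> X"
  shows "submodule (\<Union>C) R M"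
proof (rule submoduleI)
  show "\<Union>C \<subseteq> carrier M" using submodule_closed[OF sub] by blast
  show "\<zero>\<^bsub>M\<^esub> \<in> \<Union>C" using assms(1) submodule_zero_closed[OF sub] by blast
  show "\<ominus>\<^bsub>M\<^esub> a \<in> \<Union>C" if "a \<in> \<Union>C" for a using that submoduleE(3)[OF sub] by blast
  show "c \<odot>\<^bsub>M\<^esub> a \<in> \<Union>C" if "c \<in> carrier R" "a \<in> \<Union>C" for c a
    using that submoduleE(4)[OF sub] by blast
  show "a \<oplus>\<^bsub>M\<^esub> b \<in> \<Union>C" if ab: "a \<in> \<Union>C" "b \<in> \<Union>C" for a b
  proof -
    obtain X Y where XY: "X \<in> C" "a \<in> X" "Y \<in> C" "b \<in> Y" using ab by blast
    then consider "a \<in> Y" | "b \<in> X" using chain by blast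
    then show ?thesis using XY submoduleE(5)[OF sub] by cases blast+
  qed
qed

end

locale module_homomorphism = M: module R M + N: module R N
  for R :: "('r,'c) ring_scheme" (structure) and M :: "('r,'m) module" and N :: "('r,'n) module" +
  fixes h :: "'m \<Rightarrow> 'n"
  assumes hom: "h \<in> module_hom R M N"
begin

sublocale abelian_group_hom M N h
  by (intro abelian_group_homI group_hom.intro group_hom_axioms.intro M.M.abelian_group_axioms
      N.M.abelian_group_axioms M.M.a_group N.M.a_group)
    (use hom in \<open>auto simp: module_hom_def hom_def\<close>)

declare kernel_zero [simp del]  \<comment> \<open>loops together with \<open>a_kernel_def'\<close>\<close>

lemma hom_smult [simp]: "\<lbrakk>c \<in> carrier R; x \<in> carrier M\<rbrakk> \<Longrightarrow> h (c \<odot>\<^bsub>M\<^esub> x) = c \<odot>\<^bsub>N\<^esub> h x"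
  using hom by (simp add: module_hom_def)

lemma hom_eq_iff:
  assumes "x \<in> carrier M" "y \<in> carrier M"
  shows "h x = h y \<longleftrightarrow> x \<ominus>\<^bsub>M\<^esub> y \<in> a_kernel M N h"
  using assms N.M.add.inv_solve_right'[of "\<zero>\<^bsub>N\<^esub>" "h x" "h y"]
  by (simp add: a_kernel_def' M.M.minus_eq)

lemma submodule_image:
  assumes A: "submodule A R M"
  shows "submodule (h ` A) R N"
proof (rule N.submoduleI)
  note AE = M.submoduleE[OF A] and AM = M.submodule_closed[OF A]
  show "h ` A \<subseteq> carrier N" using AM by auto
  show "\<zero>\<^bsub>N\<^esub> \<in> h ` A" using M.submodule_zero_closed[OF A] by (intro image_eqI[of _ _ "\<zero>\<^bsub>M\<^esub>"]) auto
  show "\<ominus>\<^bsub>N\<^esub> a \<in> h ` A" if "a \<in> h ` A" for a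
    using that AM AE(3) by (auto simp flip: hom_a_inv)
  show "a \<oplus>\<^bsub>N\<^esub> b \<in> h ` A" if "a \<in> h ` A" "b \<in> h ` A" for a b
    using that AM AE(5) by (auto simp flip: hom_add)
  show "c \<odot>\<^bsub>N\<^esub> x \<in> h ` A" if "c \<in> carrier R" "x \<in> h ` A" for c x
    using that AM AE(4) by (auto simp flip: hom_smult)
qed

lemma submodule_vimage:
  assumes L: "submodule L R N"
  shows "submodule {x \<in> carrier M. h x \<in> L} R M"
  using N.submoduleE[OF L] N.submodule_zero_closed[OF L] by (intro M.submoduleI) auto

end

locale module_epimorphism = M: module R M
  for R :: "('r,'c) ring_scheme" (structure) and M :: "('r,'m) module" +
  fixes Q :: "('r,'q) module" and \<pi> :: "'m \<Rightarrow> 'q"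
  assumes epi_hom: "\<pi> \<in> module_hom R M Q"
    and image_eq: "\<pi> ` carrier M = carrier Q"
    and image_zero: "\<pi> \<zero>\<^bsub>M\<^esub> = \<zero>\<^bsub>Q\<^esub>"
begin

lemma module_target: "module R Q"
proof -
  have add: "\<pi> x \<oplus>\<^bsub>Q\<^esub> \<pi> y = \<pi> (x \<oplus>\<^bsub>M\<^esub> y)" if "x \<in> carrier M" "y \<in> carrier M" for x y
    using that epi_hom by (simp add: module_hom_def)
  have smult: "c \<odot>\<^bsub>Q\<^esub> \<pi> x = \<pi> (c \<odot>\<^bsub>M\<^esub> x)" if "c \<in> carrier R" "x \<in> carrier M" for c x
    using that epi_hom by (simp add: module_hom_def)
  have "\<pi> \<in> hom (add_monoid M) (add_monoid Q)"
    using epi_hom by (auto simp: hom_def module_hom_def)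
  from M.M.add.hom_imp_img_comm_group[OF this] have "comm_group (add_monoid Q)"
    by (simp add: image_eq image_zero)
  then have "abelian_group Q" by (rule comm_group_abelian_groupI)
  then show ?thesis
    by (rule moduleI[OF M.R.is_cring]) (auto simp: add smult M.smult_l_distr M.smult_r_distr
        M.smult_assoc1 simp flip: image_eq)
qed

sublocale module_homomorphism R M Q \<pi>
  by (intro module_homomorphism.intro module_homomorphism_axioms.intro M.module_axioms
      module_target epi_hom)

end

lemma module_epimorphism_comp:
  assumes "module_epimorphism R M Q \<pi>" "module_epimorphism R Q T \<rho>"
  shows "module_epimorphism R M T (\<rho> \<circ> \<pi>)"
proof -
  interpret \<pi>: module_epimorphism R M Q \<pi> by fact
  interpret \<rho>: module_epimorphism R Q T \<rho> by fact
  show ?thesis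
  proof
    show "\<rho> \<circ> \<pi> \<in> module_hom R M T" by (simp add: module_hom_def)
    show "(\<rho> \<circ> \<pi>) ` carrier M = carrier T"
      unfolding image_comp[symmetric] \<pi>.image_eq \<rho>.image_eq ..
  qed simp
qed

lemma a_kernel_comp:
  "h ` carrier M \<subseteq> carrier N \<Longrightarrow> a_kernel M T (k \<circ> h) = {x \<in> carrier M. h x \<in> a_kernel N T k}"
  by (auto simp: a_kernel_def')

lemma quot_module_epimorphism:
  assumes M: "module R M" and K: "submodule K R M"
  shows "module_epimorphism R M (quot_module M K) (a_r_coset M K)"
proof -
  interpret M: module R M by fact
  interpret K: abelian_subgroup K M by (rule M.submodule_imp_abelian_subgroup[OF K])
  have car: "a_r_coset M K ` carrier M = carrier (quot_module M K)"
    by (auto simp: quot_module_def A_RCOSETS_def' a_r_coset_def')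
  have zero: "K +>\<^bsub>M\<^esub> \<zero>\<^bsub>M\<^esub> = \<zero>\<^bsub>quot_module M K\<^esub>"
    by (simp add: quot_module_def M.M.a_coset_add_zero K.a_subset)
  have "K +>\<^bsub>M\<^esub> (c \<odot>\<^bsub>M\<^esub> y) = K +>\<^bsub>M\<^esub> (c \<odot>\<^bsub>M\<^esub> x)"
    if c: "c \<in> carrier R" and x: "x \<in> carrier M" and y: "y \<in> K +>\<^bsub>M\<^esub> x" for c x y
  proof -
    have yM: "y \<in> carrier M" using K.a_elemrcos_carrier[OF x y] .
    have "c \<odot>\<^bsub>M\<^esub> (y \<oplus>\<^bsub>M\<^esub> \<ominus>\<^bsub>M\<^esub> x) \<in> K"
      using M.submoduleE(4)[OF K c K.a_rcos_module_imp[OF x y]] .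
    then have "c \<odot>\<^bsub>M\<^esub> y \<in> K +>\<^bsub>M\<^esub> (c \<odot>\<^bsub>M\<^esub> x)"
      using c x yM by (intro K.a_rcos_module_rev) (simp_all add: M.smult_r_distr M.smult_r_minus)
    then show ?thesis using K.a_repr_independence' c x by simp
  qed
  then have "(\<Union>y\<in>K +>\<^bsub>M\<^esub> x. K +>\<^bsub>M\<^esub> (c \<odot>\<^bsub>M\<^esub> y)) = K +>\<^bsub>M\<^esub> (c \<odot>\<^bsub>M\<^esub> x)"
    if "c \<in> carrier R" "x \<in> carrier M" for c x
    using that K.a_rcos_self[OF that(2)] by blast
  then have "a_r_coset M K \<in> module_hom R M (quot_module M K)"
    using car by (auto simp: module_hom_def quot_module_def K.a_rcos_sum)
  then show ?thesis by (intro module_epimorphism.intro module_epimorphism_axioms.intro M car zero)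
qed

lemma a_kernel_quot_module:
  assumes M: "module R M" and K: "submodule K R M"
  shows "a_kernel M (quot_module M K) (a_r_coset M K) = K"
proof -
  interpret M: module R M by fact
  interpret K: abelian_subgroup K M by (rule M.submodule_imp_abelian_subgroup[OF K])
  have "K +>\<^bsub>M\<^esub> x = K \<longleftrightarrow> x \<in> K" if "x \<in> carrier M" for x
    using K.a_rcos_self[OF that] K.a_rcos_const by auto
  then show ?thesis
    using M.submodule_closed[OF K] by (fastforce simp: a_kernel_def' quot_module_def)
qed

definition transport_module :: "('m \<Rightarrow> 'q) \<Rightarrow> ('r,'m) module \<Rightarrow> ('r,'q) module" where
  "transport_module i M = (let j = inv_into (carrier M) i in
     \<lparr>carrier = i ` carrier M, mult = (\<lambda>_ _. i \<zero>\<^bsub>M\<^esub>), one = i \<zero>\<^bsub>M\<^esub>, zero = i \<zero>\<^bsub>M\<^esub>,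
      add = (\<lambda>x y. i (j x \<oplus>\<^bsub>M\<^esub> j y)), smult = (\<lambda>c x. i (c \<odot>\<^bsub>M\<^esub> j x))\<rparr>)"

lemma transport_module_epimorphism:
  assumes M: "module R M" and i: "inj_on i (carrier M)"
  shows "module_epimorphism R M (transport_module i M) i"
proof -
  interpret M: module R M by fact
  show ?thesis
    using i by unfold_locales (auto simp: module_hom_def transport_module_def Let_def)
qed

lemma a_kernel_transport_module:
  assumes M: "module R M" and i: "inj_on i (carrier M)"
  shows "a_kernel M (transport_module i M) i = {\<zero>\<^bsub>M\<^esub>}"
proof -
  interpret M: module R M by fact
  show ?thesis
    using inj_onD[OF i] by (auto simp: a_kernel_def' transport_module_def Let_def)
qed

context module_epimorphism
begin

lemma transport_comp_epimorphism:
  assumes i: "inj_on i (carrier Q)"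
  shows "module_epimorphism R M (transport_module i Q) (i \<circ> \<pi>)"
  by (rule module_epimorphism_comp[OF module_epimorphism_axioms
        transport_module_epimorphism[OF module_target i]])

lemma a_kernel_transport_comp:
  assumes i: "inj_on i (carrier Q)"
  shows "a_kernel M (transport_module i Q) (i \<circ> \<pi>) = a_kernel M Q \<pi>"
proof -
  have "a_kernel M (transport_module i Q) (i \<circ> \<pi>)
      = {x \<in> carrier M. \<pi> x \<in> a_kernel Q (transport_module i Q) i}"
    by (rule a_kernel_comp) (simp add: image_eq)
  also have "\<dots> = a_kernel M Q \<pi>"
    unfolding a_kernel_transport_module[OF module_target i] by (simp add: a_kernel_def')
  finally show ?thesis .
qed

end

section \<open>Tensor products with cyclic modules\<close>

definition self_module :: "('r,'c) ring_scheme \<Rightarrow> ('r,'r) module" where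
  "self_module R = \<lparr>carrier = carrier R, mult = mult R, one = one R, zero = zero R,
     add = add R, smult = mult R\<rparr>"

lemma self_module_simps [simp]:
  "carrier (self_module R) = carrier R" "\<zero>\<^bsub>self_module R\<^esub> = \<zero>\<^bsub>R\<^esub>"
  "x \<oplus>\<^bsub>self_module R\<^esub> y = x \<oplus>\<^bsub>R\<^esub> y" "c \<odot>\<^bsub>self_module R\<^esub> x = c \<otimes>\<^bsub>R\<^esub> x"
  "\<ominus>\<^bsub>self_module R\<^esub> x = \<ominus>\<^bsub>R\<^esub> x" "x \<ominus>\<^bsub>self_module R\<^esub> y = x \<ominus>\<^bsub>R\<^esub> y"
  by (simp_all add: self_module_def a_inv_def a_minus_def m_inv_def)

lemma (in cring) module_self_module: "module R (self_module R)"
proof (rule moduleI)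
  show "abelian_group (self_module R)"
    by (rule abelian_groupI) (auto simp: a_ac intro: add.l_inv_ex)
qed (auto simp: l_distr r_distr m_assoc is_cring)

definition fun_module :: "('s,'c) ring_scheme \<Rightarrow> ('s, 'p \<Rightarrow> 's) module" where
  "fun_module S = \<lparr>carrier = UNIV \<rightarrow> carrier S, mult = (\<lambda>\<phi> \<psi> p. \<phi> p \<otimes>\<^bsub>S\<^esub> \<psi> p), one = (\<lambda>_. \<one>\<^bsub>S\<^esub>),
     zero = (\<lambda>_. \<zero>\<^bsub>S\<^esub>), add = fadd S, smult = fscale S\<rparr>"

lemma fun_module_simps [simp]:
  "carrier (fun_module S) = UNIV \<rightarrow> carrier S" "\<zero>\<^bsub>fun_module S\<^esub> = (\<lambda>_. \<zero>\<^bsub>S\<^esub>)"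
  "add (fun_module S) = fadd S" "smult (fun_module S) = fscale S"
  by (simp_all add: fun_module_def)

context cring
begin

lemma module_fun_module: "module R (fun_module R)"
proof (rule moduleI)
  show "abelian_group (fun_module R)"
  proof (rule abelian_groupI)
    fix \<phi> assume "\<phi> \<in> carrier (fun_module R)"
    then show "\<exists>\<psi>\<in>carrier (fun_module R). \<psi> \<oplus>\<^bsub>fun_module R\<^esub> \<phi> = \<zero>\<^bsub>fun_module R\<^esub>"
      by (intro bexI[of _ "\<lambda>p. \<ominus> \<phi> p"]) (auto simp: fadd_def l_neg Pi_iff)
  qed (auto simp: fadd_def Pi_iff a_ac)
qed (auto simp: fadd_def fscale_def Pi_iff is_cring l_distr r_distr m_assoc)

lemma fun_module_uminus:
  assumes "\<phi> \<in> UNIV \<rightarrow> carrier R"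
  shows "\<ominus>\<^bsub>fun_module R\<^esub> \<phi> = (\<lambda>p. \<ominus> \<phi> p)"
proof -
  interpret F: module R "fun_module R" by (rule module_fun_module)
  show ?thesis
    using assms by (intro F.M.minus_equality) (auto simp: fadd_def l_neg Pi_iff)
qed

lemma fun_module_minus:
  assumes "\<phi> \<in> UNIV \<rightarrow> carrier R" "\<psi> \<in> UNIV \<rightarrow> carrier R"
  shows "\<phi> \<ominus>\<^bsub>fun_module R\<^esub> \<psi> = fminus R \<phi> \<psi>"
  using assms by (simp add: a_minus_def fun_module_uminus fadd_def fminus_def)

lemma fdelta_closed [simp]: "fdelta R p \<in> UNIV \<rightarrow> carrier R"
  by (simp add: fdelta_def)

lemma fsupp_closed: "\<phi> \<in> fsupp R X Y \<Longrightarrow> \<phi> \<in> UNIV \<rightarrow> carrier R"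
  by (auto simp: fsupp_def)

lemma fsupp_mono: "X \<subseteq> X' \<Longrightarrow> fsupp R X Y \<subseteq> fsupp R X' Y"
  by (auto simp: fsupp_def)

lemma fdelta_fsupp: "\<lbrakk>x \<in> X; y \<in> Y\<rbrakk> \<Longrightarrow> fdelta R (x, y) \<in> fsupp R X Y"
  by (auto simp: fsupp_def fdelta_def)

lemma submodule_fsupp: "submodule (fsupp R X Y) R (fun_module R)"
proof -
  interpret F: module R "fun_module R" by (rule module_fun_module)
  have smult: "c \<odot>\<^bsub>fun_module R\<^esub> \<phi> \<in> fsupp R X Y" if "c \<in> carrier R" "\<phi> \<in> fsupp R X Y" for c \<phi>
  proof -
    have "{p. fscale R c \<phi> p \<noteq> \<zero>} \<subseteq> {p. \<phi> p \<noteq> \<zero>}"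
      using that(1) by (auto simp: fscale_def)
    with that show ?thesis
      unfolding fsupp_def using finite_subset by (fastforce simp: fscale_def)
  qed
  show ?thesis
  proof (rule F.submoduleI)
    show "fsupp R X Y \<subseteq> carrier (fun_module R)" using fsupp_closed by auto
    show "\<zero>\<^bsub>fun_module R\<^esub> \<in> fsupp R X Y" by (simp add: fsupp_def)
    show "\<ominus>\<^bsub>fun_module R\<^esub> \<phi> \<in> fsupp R X Y" if "\<phi> \<in> fsupp R X Y" for \<phi>
      using smult[of "\<ominus> \<one>" \<phi>] F.smult_l_minus[of \<one> \<phi>] F.smult_one[of \<phi>] fsupp_closed[OF that] that
      by simp
    show "\<phi> \<oplus>\<^bsub>fun_module R\<^esub> \<psi> \<in> fsupp R X Y" if "\<phi> \<in> fsupp R X Y" "\<psi> \<in> fsupp R X Y" for \<phi> \<psi>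
    proof -
      have "{p. fadd R \<phi> \<psi> p \<noteq> \<zero>} \<subseteq> {p. \<phi> p \<noteq> \<zero>} \<union> {p. \<psi> p \<noteq> \<zero>}"
        by (auto simp: fadd_def)
      with that show ?thesis
        unfolding fsupp_def using finite_subset by (fastforce simp: fadd_def)
    qed
  qed (rule smult)
qed

lemma fadd_fsupp: "\<lbrakk>\<phi> \<in> fsupp R X Y; \<psi> \<in> fsupp R X Y\<rbrakk> \<Longrightarrow> fadd R \<phi> \<psi> \<in> fsupp R X Y"
  using module.submoduleE(5)[OF module_fun_module submodule_fsupp] by simp

lemma fscale_fsupp: "\<lbrakk>c \<in> carrier R; \<phi> \<in> fsupp R X Y\<rbrakk> \<Longrightarrow> fscale R c \<phi> \<in> fsupp R X Y"
  using module.submoduleE(4)[OF module_fun_module submodule_fsupp] by simp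

lemma fminus_fsupp: "\<lbrakk>\<phi> \<in> fsupp R X Y; \<psi> \<in> fsupp R X Y\<rbrakk> \<Longrightarrow> fminus R \<phi> \<psi> \<in> fsupp R X Y"
  using module.submodule_minus_closed[OF module_fun_module submodule_fsupp]
  by (simp add: fsupp_closed flip: fun_module_minus)

lemma fspan_least:
  assumes W: "submodule W R (fun_module R)" and G: "G \<subseteq> W"
  shows "fspan R G \<subseteq> W"
proof
  interpret F: module R "fun_module R" by (rule module_fun_module)
  note WE = F.submoduleE[OF W, simplified]
  fix v assume "v \<in> fspan R G"
  then show "v \<in> W"
  proof induction
    case fspan_zero
    show ?case using F.submodule_zero_closed[OF W] by simp
  next
    case (fspan_step g c v)
    then show ?case using WE(4,5) G by blast
  qed
qed

lemma fspan_base: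
  assumes G: "G \<subseteq> UNIV \<rightarrow> carrier R" and g: "g \<in> G"
  shows "g \<in> fspan R G"
proof -
  have "fadd R (fscale R \<one> g) (\<lambda>_. \<zero>) = g"
    using G g by (auto simp: fadd_def fscale_def Pi_iff)
  then show ?thesis using fspan.fspan_step[OF g one_closed fspan.fspan_zero] by simp
qed

lemma submodule_fspan:
  assumes G: "G \<subseteq> UNIV \<rightarrow> carrier R"
  shows "submodule (fspan R G) R (fun_module R)"
proof -
  interpret F: module R "fun_module R" by (rule module_fun_module)
  have span: "fspan R G \<subseteq> UNIV \<rightarrow> carrier R"
    using fspan_least[OF F.carrier_is_submodule] G by simp
  have add: "fadd R v w \<in> fspan R G" if "v \<in> fspan R G" and w: "w \<in> fspan R G" for v w
    using that(1)
  proof induction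
    case fspan_zero
    show ?case using F.M.l_zero[of w] w span by (simp add: subset_iff)
  next
    case (fspan_step g c v)
    have "fadd R (fadd R (fscale R c g) v) w = fadd R (fscale R c g) (fadd R v w)"
      using F.M.a_assoc[of "fscale R c g" v w] F.smult_closed[of c g] fspan_step(1-3) w span G
      by (simp add: subset_iff)
    then show ?case using fspan.fspan_step[OF fspan_step.hyps(1,2) fspan_step.IH] by (simp only:)
  qed
  have smult: "fscale R d v \<in> fspan R G" if d: "d \<in> carrier R" and "v \<in> fspan R G" for d v
    using that(2)
  proof induction
    case fspan_zero
    show ?case using d by (simp add: fscale_def fspan.fspan_zero)
  next
    case (fspan_step g c v)
    have "fscale R d (fadd R (fscale R c g) v) = fadd R (fscale R (d \<otimes> c) g) (fscale R d v)"
      using F.smult_r_distr[of d "fscale R c g" v] F.smult_assoc1[of d c g] F.smult_closed[of c g]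
        fspan_step(1-3) d span G
      by (simp add: subset_iff)
    then show ?case
      using fspan.fspan_step[OF fspan_step.hyps(1) m_closed[OF d fspan_step.hyps(2)] fspan_step.IH]
      by (simp only:)
  qed
  have uminus: "\<ominus>\<^bsub>fun_module R\<^esub> v = fscale R (\<ominus> \<one>) v" if "v \<in> fspan R G" for v
    using F.smult_l_minus[of \<one> v] F.smult_one[of v] that span by (simp add: subset_iff)
  show ?thesis
    by (rule F.submoduleI) (use span fspan.fspan_zero add smult uminus in auto)
qed

lemma fsupp_fun_upd_zero: "\<phi> \<in> fsupp R X Y \<Longrightarrow> \<phi>(p := \<zero>) \<in> fsupp R X Y"
proof -
  assume \<phi>: "\<phi> \<in> fsupp R X Y"
  have "{q. (\<phi>(p := \<zero>)) q \<noteq> \<zero>} = {q. \<phi> q \<noteq> \<zero>} - {p}" by auto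
  then show ?thesis using \<phi> unfolding fsupp_def mem_Collect_eq by auto
qed

lemma fun_upd_zero_add_scale_fdelta:
  assumes "\<And>q. \<phi> q \<in> carrier R"
  shows "fadd R (fscale R (\<phi> p) (fdelta R p)) (\<phi>(p := \<zero>)) = \<phi>"
  by (rule ext) (simp add: assms fadd_def fscale_def fdelta_def)

lemma fsupp_subset_fspan_fdelta: "fsupp R X Y \<subseteq> fspan R {fdelta R (x, y) | x y. x \<in> X \<and> y \<in> Y}"
proof
  let ?W = "fspan R {fdelta R (x, y) | x y. x \<in> X \<and> y \<in> Y}"
  fix \<phi> assume \<phi>: "\<phi> \<in> fsupp R X Y"
  then have "finite {p. \<phi> p \<noteq> \<zero>}" by (simp add: fsupp_def)
  then show "\<phi> \<in> ?W"
    using \<phi>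
  proof (induction "{p. \<phi> p \<noteq> \<zero>}" arbitrary: \<phi> rule: finite_induct)
    case empty
    then have "\<phi> p = \<zero>" for p by blast
    then have "\<phi> = (\<lambda>_. \<zero>)" by (rule ext)
    then show ?case by (simp only: fspan.fspan_zero)
  next
    case (insert p D)
    have coeff: "\<phi> q \<in> carrier R" for q using fsupp_closed[OF insert.prems] by auto
    have "D = {q. (\<phi>(p := \<zero>)) q \<noteq> \<zero>}" using insert.hyps(2,4) by auto
    then have tail: "\<phi>(p := \<zero>) \<in> ?W"
      by (rule insert.hyps(3)) (rule fsupp_fun_upd_zero[OF insert.prems])
    have "p \<in> X \<times> Y" using insert.hyps(4) insert.prems unfolding fsupp_def by blast
    then have "fdelta R p \<in> {fdelta R (x, y) | x y. x \<in> X \<and> y \<in> Y}" by blast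
    from fspan.fspan_step[OF this coeff[of p] tail] show ?case
      unfolding fun_upd_zero_add_scale_fdelta[of \<phi>, OF coeff] .
  qed
qed

end

locale tensor_evaluation = B: module S B
  for S :: "('s,'c) ring_scheme" (structure) and B :: "('s,'b) module" +
  fixes Y :: "'n set" and \<sigma> :: "'n \<Rightarrow> 's"
  assumes \<sigma>_closed [simp]: "y \<in> Y \<Longrightarrow> \<sigma> y \<in> carrier S"
begin

definition tensor_eval :: "('b \<times> 'n \<Rightarrow> 's) \<Rightarrow> 'b" where
  "tensor_eval \<phi> = (\<Oplus>\<^bsub>B\<^esub>p\<in>{p. \<phi> p \<noteq> \<zero>}. (\<phi> p \<otimes> \<sigma> (snd p)) \<odot>\<^bsub>B\<^esub> fst p)"

lemma tensor_eval_superset: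
  assumes \<phi>: "\<phi> \<in> fsupp S (carrier B) Y" and F: "finite F" "F \<subseteq> carrier B \<times> Y"
    and supp: "{p. \<phi> p \<noteq> \<zero>} \<subseteq> F"
  shows "tensor_eval \<phi> = (\<Oplus>\<^bsub>B\<^esub>p\<in>F. (\<phi> p \<otimes> \<sigma> (snd p)) \<odot>\<^bsub>B\<^esub> fst p)"
  unfolding tensor_eval_def
proof (rule B.M.add.finprod_mono_neutral_cong_left[OF F(1) supp _ refl])
  have "\<phi> p \<in> carrier S" for p using B.R.fsupp_closed[OF \<phi>] by auto
  then show "(\<lambda>p. (\<phi> p \<otimes> \<sigma> (snd p)) \<odot>\<^bsub>B\<^esub> fst p) \<in> F \<rightarrow> carrier B"
    using F(2) by auto
qed (use F(2) in auto)

lemma tensor_eval_closed: "\<phi> \<in> fsupp S (carrier B) Y \<Longrightarrow> tensor_eval \<phi> \<in> carrier B"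
  unfolding tensor_eval_def by (rule B.M.finsum_closed) (force simp: fsupp_def)

lemma tensor_eval_add_scale:
  assumes \<phi>: "\<phi> \<in> fsupp S (carrier B) Y" and \<psi>: "\<psi> \<in> fsupp S (carrier B) Y"
    and c: "c \<in> carrier S"
  shows "tensor_eval (fadd S (fscale S c \<phi>) \<psi>) = c \<odot>\<^bsub>B\<^esub> tensor_eval \<phi> \<oplus>\<^bsub>B\<^esub> tensor_eval \<psi>"
proof -
  let ?F = "{p. \<phi> p \<noteq> \<zero>} \<union> {p. \<psi> p \<noteq> \<zero>}"
  let ?e = "\<lambda>\<phi> p. (\<phi> p \<otimes> \<sigma> (snd p)) \<odot>\<^bsub>B\<^esub> fst p"
  have F: "finite ?F" "?F \<subseteq> carrier B \<times> Y"
    using \<phi> \<psi> by (auto simp: fsupp_def)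
  have coeff: "\<phi> p \<in> carrier S" "\<psi> p \<in> carrier S" for p
    using B.R.fsupp_closed[OF \<phi>] B.R.fsupp_closed[OF \<psi>] by auto
  have e: "?e \<phi> \<in> ?F \<rightarrow> carrier B" "?e \<psi> \<in> ?F \<rightarrow> carrier B"
    using F(2) coeff by (auto intro!: B.smult_closed)
  have pointwise: "?e (fadd S (fscale S c \<phi>) \<psi>) p = c \<odot>\<^bsub>B\<^esub> ?e \<phi> p \<oplus>\<^bsub>B\<^esub> ?e \<psi> p" if "p \<in> ?F" for p
  proof -
    have "fst p \<in> carrier B" "snd p \<in> Y" using that F(2) by auto
    then show ?thesis
      using c coeff
      by (simp add: fadd_def fscale_def B.R.l_distr B.smult_l_distr B.R.m_assoc B.smult_assoc1)
  qed
  have "fadd S (fscale S c \<phi>) \<psi> \<in> fsupp S (carrier B) Y"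
    using c \<phi> \<psi> by (intro B.R.fadd_fsupp B.R.fscale_fsupp)
  then have "tensor_eval (fadd S (fscale S c \<phi>) \<psi>) = finsum B (?e (fadd S (fscale S c \<phi>) \<psi>)) ?F"
    by (rule tensor_eval_superset[OF _ F]) (use c in \<open>auto simp: fadd_def fscale_def\<close>)
  also have "\<dots> = (\<Oplus>\<^bsub>B\<^esub>p\<in>?F. c \<odot>\<^bsub>B\<^esub> ?e \<phi> p \<oplus>\<^bsub>B\<^esub> ?e \<psi> p)"
    by (rule B.M.finsum_cong'[OF refl _ pointwise]) (use e c in \<open>auto simp: Pi_iff\<close>)
  also have "\<dots> = (\<Oplus>\<^bsub>B\<^esub>p\<in>?F. c \<odot>\<^bsub>B\<^esub> ?e \<phi> p) \<oplus>\<^bsub>B\<^esub> finsum B (?e \<psi>) ?F"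
    by (rule B.M.finsum_addf) (use e c in auto)
  also have "(\<Oplus>\<^bsub>B\<^esub>p\<in>?F. c \<odot>\<^bsub>B\<^esub> ?e \<phi> p) = c \<odot>\<^bsub>B\<^esub> finsum B (?e \<phi>) ?F"
    by (rule B.finsum_smult_ldistr[symmetric, OF F(1) c e(1)])
  finally show ?thesis
    using tensor_eval_superset[OF \<phi> F] tensor_eval_superset[OF \<psi> F] by simp
qed

lemma tensor_eval_zero: "tensor_eval (\<lambda>_. \<zero>) = \<zero>\<^bsub>B\<^esub>"
  by (simp add: tensor_eval_def)

lemma tensor_eval_fscale:
  assumes "c \<in> carrier S" "\<phi> \<in> fsupp S (carrier B) Y"
  shows "tensor_eval (fscale S c \<phi>) = c \<odot>\<^bsub>B\<^esub> tensor_eval \<phi>"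
proof -
  have "fscale S c \<phi> = fadd S (fscale S c \<phi>) (\<lambda>_. \<zero>)"
    using assms B.R.fsupp_closed[OF assms(2)] by (auto simp: fadd_def fscale_def Pi_iff)
  moreover have "(\<lambda>_. \<zero>) \<in> fsupp S (carrier B) Y" by (simp add: fsupp_def)
  ultimately show ?thesis
    using tensor_eval_add_scale[OF assms(2) _ assms(1)] tensor_eval_closed[OF assms(2)] assms(1)
    by (metis B.M.r_zero B.smult_closed tensor_eval_zero)
qed

lemma tensor_eval_fadd:
  assumes "\<phi> \<in> fsupp S (carrier B) Y" "\<psi> \<in> fsupp S (carrier B) Y"
  shows "tensor_eval (fadd S \<phi> \<psi>) = tensor_eval \<phi> \<oplus>\<^bsub>B\<^esub> tensor_eval \<psi>"
proof -
  have "fscale S \<one> \<phi> = \<phi>"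
    using B.R.fsupp_closed[OF assms(1)] by (auto simp: fscale_def Pi_iff)
  then show ?thesis
    using tensor_eval_add_scale[OF assms B.R.one_closed] tensor_eval_closed[OF assms(1)] by simp
qed

lemma tensor_eval_fminus:
  assumes "\<phi> \<in> fsupp S (carrier B) Y" "\<psi> \<in> fsupp S (carrier B) Y"
  shows "tensor_eval (fminus S \<phi> \<psi>) = tensor_eval \<phi> \<ominus>\<^bsub>B\<^esub> tensor_eval \<psi>"
proof -
  have "fminus S \<phi> \<psi> = fadd S (fscale S (\<ominus> \<one>) \<psi>) \<phi>"
    using B.R.fsupp_closed[OF assms(1)] B.R.fsupp_closed[OF assms(2)]
    by (auto simp: fminus_def fadd_def fscale_def Pi_iff B.R.minus_eq B.R.l_minus B.R.a_comm)
  then show ?thesis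
    using tensor_eval_add_scale[OF assms(2,1), of "\<ominus> \<one>"] tensor_eval_closed[OF assms(1)]
      tensor_eval_closed[OF assms(2)]
    by (simp add: B.smult_l_minus B.M.minus_eq B.M.a_comm)
qed

lemma tensor_eval_fdelta:
  assumes "x \<in> carrier B" "y \<in> Y"
  shows "tensor_eval (fdelta S (x, y)) = \<sigma> y \<odot>\<^bsub>B\<^esub> x"
proof -
  have "tensor_eval (fdelta S (x, y))
    = (\<Oplus>\<^bsub>B\<^esub>p\<in>{(x, y)}. (fdelta S (x, y) p \<otimes> \<sigma> (snd p)) \<odot>\<^bsub>B\<^esub> fst p)"
    by (rule tensor_eval_superset[OF B.R.fdelta_fsupp]) (use assms in \<open>auto simp: fdelta_def\<close>)
  also have "\<dots> = \<sigma> y \<odot>\<^bsub>B\<^esub> x"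
    using assms by (simp add: fdelta_def)
  finally show ?thesis .
qed

end

lemma tensor_rels_cases:
  assumes "g \<in> tensor_rels S M N X"
  obtains
    (add_left) x x' n where "x \<in> X" "x' \<in> X" "n \<in> carrier N"
      "g = fminus S (fdelta S (x \<oplus>\<^bsub>M\<^esub> x', n)) (fadd S (fdelta S (x, n)) (fdelta S (x', n)))"
  | (add_right) x n n' where "x \<in> X" "n \<in> carrier N" "n' \<in> carrier N"
      "g = fminus S (fdelta S (x, n \<oplus>\<^bsub>N\<^esub> n')) (fadd S (fdelta S (x, n)) (fdelta S (x, n')))"
  | (smult_left) c x n where "c \<in> carrier S" "x \<in> X" "n \<in> carrier N"
      "g = fminus S (fdelta S (c \<odot>\<^bsub>M\<^esub> x, n)) (fscale S c (fdelta S (x, n)))"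
  | (smult_right) c x n where "c \<in> carrier S" "x \<in> X" "n \<in> carrier N"
      "g = fminus S (fdelta S (x, c \<odot>\<^bsub>N\<^esub> n)) (fscale S c (fdelta S (x, n)))"
  using assms unfolding tensor_rels_def by (elim UnE CollectE exE conjE) ((rule that, assumption+)+)

text \<open>Here N is presented as S/rS, and \<open>X \<otimes> N\<close> is identified with \<open>X/rX\<close>.\<close>

locale cyclic_tensor = B: module S B + \<epsilon>: module_epimorphism S "self_module S" N \<epsilon>
  for S :: "('s,'c) ring_scheme" (structure) and B :: "('s,'b) module"
    and N :: "('s,'n) module" and \<epsilon> :: "'s \<Rightarrow> 'n" +
  fixes r :: 's
  assumes r_closed [simp]: "r \<in> carrier S"
    and kernel_eq: "a_kernel (self_module S) N \<epsilon> = PIdl r"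
begin

definition lift :: "'n \<Rightarrow> 's" where
  "lift = inv_into (carrier S) \<epsilon>"

lemma lift_closed [simp]: "n \<in> carrier N \<Longrightarrow> lift n \<in> carrier S"
  unfolding lift_def by (rule inv_into_into) (simp add: \<epsilon>.image_eq[simplified])

lemma \<epsilon>_lift [simp]: "n \<in> carrier N \<Longrightarrow> \<epsilon> (lift n) = n"
  unfolding lift_def by (rule f_inv_into_f) (simp add: \<epsilon>.image_eq[simplified])

sublocale tensor_evaluation S B "carrier N" lift
  by unfold_locales simp

lemma lift_smult_minus:
  assumes X: "submodule X S B" and x: "x \<in> X" and s: "s \<in> carrier S"
  shows "lift (\<epsilon> s) \<odot>\<^bsub>B\<^esub> x \<ominus>\<^bsub>B\<^esub> s \<odot>\<^bsub>B\<^esub> x \<in> (\<lambda>x. r \<odot>\<^bsub>B\<^esub> x) ` X"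
proof -
  have \<epsilon>s: "\<epsilon> s \<in> carrier N" using \<epsilon>.hom_closed[of s] s by simp
  then have "lift (\<epsilon> s) \<ominus> s \<in> PIdl r"
    using \<epsilon>.hom_eq_iff[of "lift (\<epsilon> s)" s] s by (simp add: kernel_eq)
  then obtain c where c: "c \<in> carrier S" "lift (\<epsilon> s) \<ominus> s = c \<otimes> r"
    by (auto simp: cgenideal_def)
  have xB: "x \<in> carrier B" using B.submodule_closed[OF X x] .
  have "lift (\<epsilon> s) \<odot>\<^bsub>B\<^esub> x \<ominus>\<^bsub>B\<^esub> s \<odot>\<^bsub>B\<^esub> x = (lift (\<epsilon> s) \<ominus> s) \<odot>\<^bsub>B\<^esub> x"
    using s \<epsilon>s xB by (simp add: B.smult_l_diff)
  also have "\<dots> = r \<odot>\<^bsub>B\<^esub> (c \<odot>\<^bsub>B\<^esub> x)"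
    using c xB by (simp add: B.R.m_comm flip: B.smult_assoc1)
  finally show ?thesis using B.submoduleE(4)[OF X c(1) x] by blast
qed

end

locale cyclic_tensor_submodule = cyclic_tensor S B N \<epsilon> r
  for S :: "('s,'c) ring_scheme" (structure) and B :: "('s,'b) module"
    and N :: "('s,'n) module" and \<epsilon> r +
  fixes X :: "'b set"
  assumes X: "submodule X S B"
begin

abbreviation rX :: "'b set" where
  "rX \<equiv> (\<lambda>x. r \<odot>\<^bsub>B\<^esub> x) ` X"

abbreviation relations :: "('b \<times> 'n \<Rightarrow> 's) set" where
  "relations \<equiv> fspan S (tensor_rels S B N X)"

abbreviation tensor_product :: "('s, ('b \<times> 'n \<Rightarrow> 's) set) module" where
  "tensor_product \<equiv> quot_module (fun_module S) relations"

definition pure_tensor :: "'b \<Rightarrow> 'n \<Rightarrow> ('b \<times> 'n \<Rightarrow> 's) set" (infixl "\<boxtimes>" 70) where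
  "x \<boxtimes> n = relations +>\<^bsub>fun_module S\<^esub> fdelta S (x, n)"

lemma X_closed [simp]: "x \<in> X \<Longrightarrow> x \<in> carrier B"
  by (rule B.submodule_closed[OF X])

lemma submodule_rX: "submodule rX S B"
  by (rule B.submodule_smult_image[OF X r_closed])

lemma tensor_rels_fsupp: "tensor_rels S B N X \<subseteq> fsupp S X (carrier N)"
  using B.submoduleE(4,5)[OF X] unfolding tensor_rels_def
  by (auto intro!: B.R.fminus_fsupp B.R.fadd_fsupp B.R.fscale_fsupp B.R.fdelta_fsupp
      \<epsilon>.N.smult_closed)

lemma tensor_rels_closed: "tensor_rels S B N X \<subseteq> UNIV \<rightarrow> carrier S"
  using tensor_rels_fsupp B.R.fsupp_closed by blast

sublocale F: module S "fun_module S :: ('s, 'b \<times> 'n \<Rightarrow> 's) module"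
  by (rule B.R.module_fun_module)

sublocale q: module_epimorphism S "fun_module S" tensor_product "a_r_coset (fun_module S) relations"
  by (rule quot_module_epimorphism[OF F.module_axioms B.R.submodule_fspan[OF tensor_rels_closed]])

lemma coset_eqI:
  assumes "\<phi> \<in> UNIV \<rightarrow> carrier S" "\<psi> \<in> UNIV \<rightarrow> carrier S" "fminus S \<phi> \<psi> \<in> relations"
  shows "relations +>\<^bsub>fun_module S\<^esub> \<phi> = relations +>\<^bsub>fun_module S\<^esub> \<psi>"
  using q.hom_eq_iff[of \<phi> \<psi>] assms
    a_kernel_quot_module[OF F.module_axioms B.R.submodule_fspan[OF tensor_rels_closed]]
  by (simp add: B.R.fun_module_minus)

lemma pure_tensor_closed [simp]: "x \<boxtimes> n \<in> carrier tensor_product"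
  unfolding pure_tensor_def by (rule q.hom_closed) simp

lemma pure_tensor_add:
  assumes "x \<in> X" "x' \<in> X" "n \<in> carrier N"
  shows "(x \<oplus>\<^bsub>B\<^esub> x') \<boxtimes> n = x \<boxtimes> n \<oplus>\<^bsub>tensor_product\<^esub> x' \<boxtimes> n"
proof -
  have "fminus S (fdelta S (x \<oplus>\<^bsub>B\<^esub> x', n)) (fadd S (fdelta S (x, n)) (fdelta S (x', n)))
      \<in> tensor_rels S B N X"
    using assms unfolding tensor_rels_def by blast
  from B.R.fspan_base[OF tensor_rels_closed this]
  have "(x \<oplus>\<^bsub>B\<^esub> x') \<boxtimes> n
      = relations +>\<^bsub>fun_module S\<^esub> (fdelta S (x, n) \<oplus>\<^bsub>fun_module S\<^esub> fdelta S (x', n))"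
    unfolding pure_tensor_def by (intro coset_eqI) (simp_all add: fadd_def fdelta_def)
  then show ?thesis
    using q.hom_add[of "fdelta S (x, n)" "fdelta S (x', n)"] by (simp add: pure_tensor_def)
qed

lemma pure_tensor_smult_left:
  assumes "c \<in> carrier S" "x \<in> X" "n \<in> carrier N"
  shows "(c \<odot>\<^bsub>B\<^esub> x) \<boxtimes> n = c \<odot>\<^bsub>tensor_product\<^esub> (x \<boxtimes> n)"
proof -
  have "fminus S (fdelta S (c \<odot>\<^bsub>B\<^esub> x, n)) (fscale S c (fdelta S (x, n))) \<in> tensor_rels S B N X"
    using assms unfolding tensor_rels_def by blast
  from B.R.fspan_base[OF tensor_rels_closed this]
  have "(c \<odot>\<^bsub>B\<^esub> x) \<boxtimes> n = relations +>\<^bsub>fun_module S\<^esub> (c \<odot>\<^bsub>fun_module S\<^esub> fdelta S (x, n))"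
    unfolding pure_tensor_def using assms(1)
    by (intro coset_eqI) (simp_all add: fscale_def fdelta_def)
  then show ?thesis
    using q.hom_smult[of c "fdelta S (x, n)"] assms(1) by (simp add: pure_tensor_def)
qed

lemma pure_tensor_smult_right:
  assumes "c \<in> carrier S" "x \<in> X" "n \<in> carrier N"
  shows "x \<boxtimes> (c \<odot>\<^bsub>N\<^esub> n) = c \<odot>\<^bsub>tensor_product\<^esub> (x \<boxtimes> n)"
proof -
  have "fminus S (fdelta S (x, c \<odot>\<^bsub>N\<^esub> n)) (fscale S c (fdelta S (x, n))) \<in> tensor_rels S B N X"
    using assms unfolding tensor_rels_def by blast
  from B.R.fspan_base[OF tensor_rels_closed this]
  have "x \<boxtimes> (c \<odot>\<^bsub>N\<^esub> n) = relations +>\<^bsub>fun_module S\<^esub> (c \<odot>\<^bsub>fun_module S\<^esub> fdelta S (x, n))"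
    unfolding pure_tensor_def using assms(1)
    by (intro coset_eqI) (simp_all add: fscale_def fdelta_def)
  then show ?thesis
    using q.hom_smult[of c "fdelta S (x, n)"] assms(1) by (simp add: pure_tensor_def)
qed

lemma pure_tensor_\<epsilon>:
  assumes "x \<in> X" "s \<in> carrier S"
  shows "x \<boxtimes> \<epsilon> s = (s \<odot>\<^bsub>B\<^esub> x) \<boxtimes> \<epsilon> \<one>"
proof -
  have "\<epsilon> s = s \<odot>\<^bsub>N\<^esub> \<epsilon> \<one>" using \<epsilon>.hom_smult[of s \<one>] assms(2) by simp
  moreover have "\<epsilon> \<one> \<in> carrier N" using \<epsilon>.hom_closed[of \<one>] by simp
  ultimately show ?thesis using assms by (simp add: pure_tensor_smult_left pure_tensor_smult_right)
qed

lemma pure_tensor_rX: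
  assumes "y \<in> rX"
  shows "y \<boxtimes> \<epsilon> \<one> = \<zero>\<^bsub>tensor_product\<^esub>"
proof -
  obtain x where x: "x \<in> X" "y = r \<odot>\<^bsub>B\<^esub> x" using assms by blast
  have "\<epsilon> r = \<zero>\<^bsub>N\<^esub>"
    using kernel_eq B.R.cgenideal_self[OF r_closed] by (auto simp: a_kernel_def')
  also have "\<dots> = \<zero> \<odot>\<^bsub>N\<^esub> \<epsilon> \<one>" using \<epsilon>.hom_closed[of \<one>] by simp
  finally have "y \<boxtimes> \<epsilon> \<one> = x \<boxtimes> (\<zero> \<odot>\<^bsub>N\<^esub> \<epsilon> \<one>)"
    using x by (simp flip: pure_tensor_\<epsilon>)
  also have "\<dots> = \<zero>\<^bsub>tensor_product\<^esub>"
    using pure_tensor_smult_right[of \<zero> x "\<epsilon> \<one>"] x(1) \<epsilon>.hom_closed[of \<one>] by simp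
  finally show ?thesis .
qed

lemma tensor_eval_add_scale_fdelta:
  assumes "c \<in> carrier S" "x \<in> X" "n \<in> carrier N" "\<psi> \<in> fsupp S X (carrier N)"
  shows "tensor_eval (fadd S (fscale S c (fdelta S (x, n))) \<psi>)
    = c \<odot>\<^bsub>B\<^esub> (lift n \<odot>\<^bsub>B\<^esub> x) \<oplus>\<^bsub>B\<^esub> tensor_eval \<psi>"
proof -
  have "\<psi> \<in> fsupp S (carrier B) (carrier N)"
    using assms(4) B.R.fsupp_mono[OF B.submoduleE(1)[OF X]] by blast
  then show ?thesis
    using tensor_eval_add_scale[OF B.R.fdelta_fsupp _ assms(1)] assms(2,3)
    by (simp add: tensor_eval_fdelta)
qed

lemma coset_eq_pure_tensor:
  assumes "\<phi> \<in> fsupp S X (carrier N)"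
  shows "tensor_eval \<phi> \<in> X" and "relations +>\<^bsub>fun_module S\<^esub> \<phi> = tensor_eval \<phi> \<boxtimes> \<epsilon> \<one>"
proof -
  note XE = B.submoduleE[OF X]
  have "\<phi> \<in> fspan S {fdelta S (x, n) | x n. x \<in> X \<and> n \<in> carrier N}"
    using assms B.R.fsupp_subset_fspan_fdelta by blast
  then have "\<phi> \<in> fsupp S X (carrier N) \<and> tensor_eval \<phi> \<in> X \<and>
    relations +>\<^bsub>fun_module S\<^esub> \<phi> = tensor_eval \<phi> \<boxtimes> \<epsilon> \<one>"
  proof induction
    case fspan_zero
    have "\<zero>\<^bsub>B\<^esub> \<in> rX" by (rule B.submodule_zero_closed[OF submodule_rX])
    then show ?case
      using q.hom_zero B.submodule_zero_closed[OF X]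
      by (simp add: tensor_eval_zero pure_tensor_rX) (simp add: fsupp_def)
  next
    case (fspan_step \<delta> c \<psi>)
    then obtain x n where \<delta>: "\<delta> = fdelta S (x, n)" "x \<in> X" "n \<in> carrier N" by blast
    have c: "c \<in> carrier S" by fact
    let ?y = "lift n \<odot>\<^bsub>B\<^esub> x"
    have supp: "\<delta> \<in> fsupp S X (carrier N)" "\<psi> \<in> fsupp S X (carrier N)"
      using \<delta> fspan_step.IH by (simp_all add: B.R.fdelta_fsupp)
    have closed: "?y \<in> X" "c \<odot>\<^bsub>B\<^esub> ?y \<in> X" "tensor_eval \<psi> \<in> X" "\<epsilon> \<one> \<in> carrier N"
      using XE(4) \<delta> c fspan_step.IH \<epsilon>.hom_closed[of \<one>] by auto
    have "relations +>\<^bsub>fun_module S\<^esub> (fadd S (fscale S c \<delta>) \<psi>)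
        = c \<odot>\<^bsub>tensor_product\<^esub> (x \<boxtimes> n) \<oplus>\<^bsub>tensor_product\<^esub> tensor_eval \<psi> \<boxtimes> \<epsilon> \<one>"
      using q.hom_add[of "fscale S c \<delta>" \<psi>] q.hom_smult[of c \<delta>] F.smult_closed[of c \<delta>] c
        supp[THEN B.R.fsupp_closed] fspan_step.IH by (simp add: pure_tensor_def flip: \<delta>(1))
    also have "x \<boxtimes> n = ?y \<boxtimes> \<epsilon> \<one>"
      using pure_tensor_\<epsilon>[of x "lift n"] \<delta> by simp
    finally show ?case
      using tensor_eval_add_scale_fdelta[OF c \<delta>(2,3) supp(2)] closed c supp XE(5)
      by (simp add: \<delta>(1) pure_tensor_add pure_tensor_smult_left B.R.fadd_fsupp B.R.fscale_fsupp)
  qed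
  then show "tensor_eval \<phi> \<in> X" and "relations +>\<^bsub>fun_module S\<^esub> \<phi> = tensor_eval \<phi> \<boxtimes> \<epsilon> \<one>"
    by auto
qed

lemma tensor_eval_tensor_rels:
  assumes "g \<in> tensor_rels S B N X"
  shows "tensor_eval g \<in> rX"
proof -
  note eval = tensor_eval_fminus tensor_eval_fadd tensor_eval_fscale tensor_eval_fdelta
    B.R.fminus_fsupp B.R.fadd_fsupp B.R.fscale_fsupp B.R.fdelta_fsupp
  have zero: "\<zero>\<^bsub>B\<^esub> \<in> rX" by (rule B.submodule_zero_closed[OF submodule_rX])
  from assms show ?thesis
  proof (cases rule: tensor_rels_cases)
    case (add_left x x' n)
    then have "tensor_eval g = \<zero>\<^bsub>B\<^esub>"
      by (simp add: eval B.smult_r_distr B.M.minus_eq B.M.r_neg)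
    then show ?thesis using zero by simp
  next
    case (add_right x n n')
    have "\<epsilon> (lift n \<oplus> lift n') = n \<oplus>\<^bsub>N\<^esub> n'"
      using \<epsilon>.hom_add[of "lift n" "lift n'"] add_right by simp
    then show ?thesis
      using lift_smult_minus[OF X add_right(1), of "lift n \<oplus> lift n'"] add_right
      by (simp add: eval B.smult_l_distr)
  next
    case (smult_left c x n)
    then have "tensor_eval g = \<zero>\<^bsub>B\<^esub>"
      by (simp add: eval B.M.minus_eq B.M.r_neg B.R.m_comm flip: B.smult_assoc1)
    then show ?thesis using zero by simp
  next
    case (smult_right c x n)
    have "\<epsilon> (c \<otimes> lift n) = c \<odot>\<^bsub>N\<^esub> n"
      using \<epsilon>.hom_smult[of c "lift n"] smult_right by simp
    then show ?thesis
      using lift_smult_minus[OF X smult_right(2), of "c \<otimes> lift n"] smult_right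
      by (simp add: eval B.smult_assoc1)
  qed
qed

lemma tensor_eval_relations:
  assumes "\<phi> \<in> relations"
  shows "tensor_eval \<phi> \<in> rX"
proof -
  note rXE = B.submoduleE[OF submodule_rX]
  have "\<phi> \<in> fsupp S (carrier B) (carrier N) \<and> tensor_eval \<phi> \<in> rX"
    using assms
  proof induction
    case fspan_zero
    show ?case
      using B.submodule_zero_closed[OF submodule_rX] by (simp add: tensor_eval_zero fsupp_def)
  next
    case (fspan_step g c v)
    have "g \<in> fsupp S (carrier B) (carrier N)"
      using tensor_rels_fsupp fspan_step(1) B.R.fsupp_mono[OF B.submoduleE(1)[OF X]] by blast
    then show ?case
      using tensor_eval_tensor_rels[OF fspan_step(1)] fspan_step(2) fspan_step.IH rXE(4,5)
      by (simp add: tensor_eval_add_scale B.R.fadd_fsupp B.R.fscale_fsupp)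
  qed
  then show ?thesis ..
qed

lemma tensor_eval_fdelta_\<epsilon>_one_iff:
  assumes y: "y \<in> X"
  shows "tensor_eval (fdelta S (y, \<epsilon> \<one>)) \<in> rX \<longleftrightarrow> y \<in> rX"
proof -
  have \<epsilon>1: "\<epsilon> \<one> \<in> carrier N" using \<epsilon>.hom_closed[of \<one>] by simp
  have "lift (\<epsilon> \<one>) \<odot>\<^bsub>B\<^esub> y \<ominus>\<^bsub>B\<^esub> y \<in> rX" using lift_smult_minus[OF X y, of \<one>] y by simp
  then show ?thesis
    using B.submodule_minus_mem_iff[OF submodule_rX, of "lift (\<epsilon> \<one>) \<odot>\<^bsub>B\<^esub> y" y] y \<epsilon>1
    by (simp add: tensor_eval_fdelta)
qed

lemma relations_iff_tensor_eval:
  assumes "\<phi> \<in> fsupp S X (carrier N)"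
  shows "\<phi> \<in> relations \<longleftrightarrow> tensor_eval \<phi> \<in> rX"
proof
  assume "tensor_eval \<phi> \<in> rX"
  then have "relations +>\<^bsub>fun_module S\<^esub> \<phi> = \<zero>\<^bsub>tensor_product\<^esub>"
    using coset_eq_pure_tensor(2)[OF assms] by (simp add: pure_tensor_rX)
  then have "\<phi> \<in> a_kernel (fun_module S) tensor_product (a_r_coset (fun_module S) relations)"
    using B.R.fsupp_closed[OF assms] by (simp add: a_kernel_def')
  then show "\<phi> \<in> relations"
    by (simp only: a_kernel_quot_module[OF F.module_axioms
        B.R.submodule_fspan[OF tensor_rels_closed]])
qed (rule tensor_eval_relations)

end

context cyclic_tensor
begin

lemma tensor_inj_iff:
  assumes A: "submodule A S B"
  shows "tensor_inj S N A B \<longleftrightarrow>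
    (\<forall>b\<in>carrier B. r \<odot>\<^bsub>B\<^esub> b \<in> A \<longrightarrow> (\<exists>a\<in>A. r \<odot>\<^bsub>B\<^esub> b = r \<odot>\<^bsub>B\<^esub> a))"
proof -
  interpret A: cyclic_tensor_submodule S B N \<epsilon> r A 
    by (intro cyclic_tensor_submodule.intro cyclic_tensor_submodule_axioms.intro
        cyclic_tensor_axioms A)
  interpret C: cyclic_tensor_submodule S B N \<epsilon> r "carrier B"
    by (intro cyclic_tensor_submodule.intro cyclic_tensor_submodule_axioms.intro
        cyclic_tensor_axioms B.carrier_is_submodule)
  have C_iff: "\<phi> \<in> C.relations \<longleftrightarrow> tensor_eval \<phi> \<in> C.rX" if "\<phi> \<in> fsupp S A (carrier N)" for \<phi>
    using that B.R.fsupp_mono[OF B.submoduleE(1)[OF A]]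
    by (intro C.relations_iff_tensor_eval) blast
  have "tensor_inj S N A B \<longleftrightarrow>
      (\<forall>\<phi>\<in>fsupp S A (carrier N). tensor_eval \<phi> \<in> C.rX \<longrightarrow> tensor_eval \<phi> \<in> A.rX)"
    by (simp add: tensor_inj_def A.relations_iff_tensor_eval C_iff)
  also have "\<dots> \<longleftrightarrow> C.rX \<inter> A \<subseteq> A.rX"
  proof
    assume *: "\<forall>\<phi>\<in>fsupp S A (carrier N). tensor_eval \<phi> \<in> C.rX \<longrightarrow> tensor_eval \<phi> \<in> A.rX"
    show "C.rX \<inter> A \<subseteq> A.rX"
    proof
      fix y assume y: "y \<in> C.rX \<inter> A"
      then have yB: "y \<in> carrier B" using B.submodule_closed[OF A] by blast
      have "fdelta S (y, \<epsilon> \<one>) \<in> fsupp S A (carrier N)"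
        using y \<epsilon>.hom_closed[of \<one>] by (intro B.R.fdelta_fsupp) auto
      then show "y \<in> A.rX"
        using * y C.tensor_eval_fdelta_\<epsilon>_one_iff[OF yB] A.tensor_eval_fdelta_\<epsilon>_one_iff[of y]
        by blast
    qed
  qed (use A.coset_eq_pure_tensor(1) in blast)
  also have "\<dots> \<longleftrightarrow> (\<forall>b\<in>carrier B. r \<odot>\<^bsub>B\<^esub> b \<in> A \<longrightarrow> (\<exists>a\<in>A. r \<odot>\<^bsub>B\<^esub> b = r \<odot>\<^bsub>B\<^esub> a))"
    by auto
  finally show ?thesis .
qed

end

section \<open>RD-purity as a divisibility condition\<close>

context cring
begin

lemma cyclic_mod_epimorphism:
  assumes r: "r \<in> carrier R"
  shows "module_epimorphism R (self_module R) (cyclic_mod R r) (a_r_coset R (PIdl r))"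
proof -
  interpret I: ideal "PIdl r" R by (rule cgenideal_ideal[OF r])
  interpret \<pi>: ring_hom_cring R "R Quot (PIdl r)" "a_r_coset R (PIdl r)"
    by (rule I.rcos_ring_hom_cring[OF is_cring])
  have "carrier (R Quot (PIdl r)) = a_r_coset R (PIdl r) ` carrier R"
    unfolding FactRing_def A_RCOSETS_def' by simp blast
  then show ?thesis
    by (intro module_epimorphism.intro module_epimorphism_axioms.intro module_self_module)
      (auto simp: module_hom_def cyclic_mod_def)
qed

lemma a_kernel_cyclic_mod:
  assumes r: "r \<in> carrier R"
  shows "a_kernel (self_module R) (cyclic_mod R r) (a_r_coset R (PIdl r)) = PIdl r"
proof -
  interpret I: ideal "PIdl r" R by (rule cgenideal_ideal[OF r])
  have "PIdl r +> x = PIdl r \<longleftrightarrow> x \<in> PIdl r" if "x \<in> carrier R" for x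
    using a_coset_join1[OF _ that I.a_subgroup] a_coset_join2[OF that I.a_subgroup] by blast
  moreover have "\<zero>\<^bsub>cyclic_mod R r\<^esub> = PIdl r" by (simp add: cyclic_mod_def FactRing_def)
  ultimately show ?thesis
    using I.Icarr by (fastforce simp: a_kernel_def')
qed

end

lemma RD_pure_iff:
  assumes B: "module R B" and A: "submodule A R B"
  shows "RD_pure R A B \<longleftrightarrow>
    (\<forall>r\<in>carrier R. \<forall>b\<in>carrier B. r \<odot>\<^bsub>B\<^esub> b \<in> A \<longrightarrow> (\<exists>a\<in>A. r \<odot>\<^bsub>B\<^esub> b = r \<odot>\<^bsub>B\<^esub> a))"
proof -
  interpret B: module R B by fact
  have "cyclic_tensor R B (cyclic_mod R r) (a_r_coset R (PIdl\<^bsub>R\<^esub> r)) r" if "r \<in> carrier R" for r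
    using B.R.cyclic_mod_epimorphism[OF that] B.R.a_kernel_cyclic_mod[OF that] that B
    by (intro cyclic_tensor.intro cyclic_tensor_axioms.intro)
  from cyclic_tensor.tensor_inj_iff[OF this A] show ?thesis by (simp add: RD_pure_def)
qed

text \<open>The test modules of \<open>pure_sub\<close> are carried by sets of lists, hence the singleton lists.\<close>

lemma pure_sub_imp_RD_pure:
  fixes S :: "('s,'c) ring_scheme"
  assumes B: "module S B" and A: "submodule A S B" and pure: "pure_sub S A B"
  shows "RD_pure S A B"
  unfolding RD_pure_iff[OF B A]
proof
  interpret B: module S B by fact
  fix r assume r: "r \<in> carrier S"
  let ?i = "(`) (\<lambda>s. [s]) :: 's set \<Rightarrow> 's list set"
  let ?\<pi> = "a_r_coset S (PIdl\<^bsub>S\<^esub> r)"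
  interpret \<pi>: module_epimorphism S "self_module S" "cyclic_mod S r" ?\<pi>
    by (rule B.R.cyclic_mod_epimorphism[OF r])
  have i: "inj_on ?i (carrier (cyclic_mod S r))"
    by (rule inj_onI) (simp add: inj_image_eq_iff inj_def)
  let ?N = "transport_module ?i (cyclic_mod S r)"
  interpret cyclic_tensor S B ?N "?i \<circ> ?\<pi>" r
    using \<pi>.transport_comp_epimorphism[OF i] \<pi>.a_kernel_transport_comp[OF i]
      B.R.a_kernel_cyclic_mod[OF r]
    by (intro cyclic_tensor.intro cyclic_tensor_axioms.intro B r) simp_all
  have "tensor_inj S ?N A B"
    using pure \<epsilon>.module_target unfolding pure_sub_def by blast
  then show "\<forall>b\<in>carrier B. r \<odot>\<^bsub>B\<^esub> b \<in> A \<longrightarrow> (\<exists>a\<in>A. r \<odot>\<^bsub>B\<^esub> b = r \<odot>\<^bsub>B\<^esub> a)"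
    by (simp only: tensor_inj_iff[OF A])
qed

section \<open>RD-essential quotients\<close>

text \<open>RD-purity and essentiality of \<open>(A + K)/K\<close> in \<open>M/K\<close>, expressed in \<open>M\<close>.\<close>

definition RD_pure_modulo ::
  "('r,'c) ring_scheme \<Rightarrow> ('r,'m) module \<Rightarrow> 'm set \<Rightarrow> 'm set \<Rightarrow> bool" where
  "RD_pure_modulo R M K A \<longleftrightarrow>
     (\<forall>r\<in>carrier R. \<forall>m\<in>carrier M. \<forall>a\<in>A. r \<odot>\<^bsub>M\<^esub> m \<ominus>\<^bsub>M\<^esub> a \<in> K \<longrightarrow>
        (\<exists>a'\<in>A. a \<ominus>\<^bsub>M\<^esub> r \<odot>\<^bsub>M\<^esub> a' \<in> K))"

definition essential_modulo ::
  "('r,'c) ring_scheme \<Rightarrow> ('r,'m) module \<Rightarrow> 'm set \<Rightarrow> 'm set \<Rightarrow> bool" where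
  "essential_modulo R M K A \<longleftrightarrow>
     (\<forall>m\<in>carrier M - K. \<exists>s\<in>carrier R. \<exists>a\<in>A - K. s \<odot>\<^bsub>M\<^esub> m \<ominus>\<^bsub>M\<^esub> a \<in> K)"

lemma RD_pure_moduloD:
  assumes "RD_pure_modulo R M K A" "r \<in> carrier R" "m \<in> carrier M" "a \<in> A"
    and "r \<odot>\<^bsub>M\<^esub> m \<ominus>\<^bsub>M\<^esub> a \<in> K"
  obtains a' where "a' \<in> A" "a \<ominus>\<^bsub>M\<^esub> r \<odot>\<^bsub>M\<^esub> a' \<in> K"
  using assms unfolding RD_pure_modulo_def by blast

lemma essential_moduloD:
  assumes "essential_modulo R M K A" "m \<in> carrier M" "m \<notin> K"
  obtains s a where "s \<in> carrier R" "a \<in> A" "a \<notin> K" "s \<odot>\<^bsub>M\<^esub> m \<ominus>\<^bsub>M\<^esub> a \<in> K"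
  using assms unfolding essential_modulo_def by blast

lemma essential_modulo_cancel_smult:
  assumes M: "module R M" and A: "submodule A R M" and K: "submodule K R M"
    and ess: "essential_modulo R M K A"
    and cancel: "\<And>a. \<lbrakk>a \<in> A; t \<odot>\<^bsub>M\<^esub> a \<in> K\<rbrakk> \<Longrightarrow> a \<in> K"
    and t: "t \<in> carrier R" and m: "m \<in> carrier M" and tm: "t \<odot>\<^bsub>M\<^esub> m \<in> K"
  shows "m \<in> K"
proof (rule ccontr)
  interpret M: module R M by fact
  assume "m \<notin> K"
  then obtain s a where s: "s \<in> carrier R" and a: "a \<in> A" "a \<notin> K" and sm: "s \<odot>\<^bsub>M\<^esub> m \<ominus>\<^bsub>M\<^esub> a \<in> K"
    using essential_moduloD[OF ess m] by blast
  have aM: "a \<in> carrier M" using M.submodule_closed[OF A a(1)] .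
  have "t \<odot>\<^bsub>M\<^esub> (s \<odot>\<^bsub>M\<^esub> m \<ominus>\<^bsub>M\<^esub> a) = s \<odot>\<^bsub>M\<^esub> (t \<odot>\<^bsub>M\<^esub> m) \<ominus>\<^bsub>M\<^esub> t \<odot>\<^bsub>M\<^esub> a"
    using s t m aM
    by (simp add: M.smult_r_diff M.R.m_comm flip: M.smult_assoc1)
  then have "s \<odot>\<^bsub>M\<^esub> (t \<odot>\<^bsub>M\<^esub> m) \<ominus>\<^bsub>M\<^esub> t \<odot>\<^bsub>M\<^esub> a \<in> K"
    using M.submoduleE(4)[OF K t sm] by simp
  then have "t \<odot>\<^bsub>M\<^esub> a \<in> K"
    using M.submodule_minus_mem_iff[OF K, of "s \<odot>\<^bsub>M\<^esub> (t \<odot>\<^bsub>M\<^esub> m)" "t \<odot>\<^bsub>M\<^esub> a"]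
        s t m aM M.submoduleE(4)[OF K s tm]
    by simp
  then show False using cancel[OF a(1)] a(2) by blast
qed

context module_epimorphism
begin

lemma RD_pure_image_iff:
  assumes A: "submodule A R M"
  shows "RD_pure R (\<pi> ` A) Q \<longleftrightarrow> RD_pure_modulo R M (a_kernel M Q \<pi>) A"
proof -
  have smult_eq: "r \<odot>\<^bsub>Q\<^esub> \<pi> x = \<pi> y \<longleftrightarrow> r \<odot>\<^bsub>M\<^esub> x \<ominus>\<^bsub>M\<^esub> y \<in> a_kernel M Q \<pi>"
    and eq_smult: "\<pi> y = r \<odot>\<^bsub>Q\<^esub> \<pi> x \<longleftrightarrow> y \<ominus>\<^bsub>M\<^esub> r \<odot>\<^bsub>M\<^esub> x \<in> a_kernel M Q \<pi>"
    if "r \<in> carrier R" "x \<in> carrier M" "y \<in> carrier M" for r x y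
    using that hom_eq_iff[of "r \<odot>\<^bsub>M\<^esub> x" y] hom_eq_iff[of y "r \<odot>\<^bsub>M\<^esub> x"] by simp_all
  have "RD_pure R (\<pi> ` A) Q \<longleftrightarrow>
    (\<forall>r\<in>carrier R. \<forall>m\<in>carrier M. \<forall>a\<in>A. r \<odot>\<^bsub>Q\<^esub> \<pi> m = \<pi> a \<longrightarrow> (\<exists>a'\<in>A. \<pi> a = r \<odot>\<^bsub>Q\<^esub> \<pi> a'))"
    unfolding RD_pure_iff[OF module_target submodule_image[OF A]] image_eq[symmetric]
    by (simp only: ball_simps bex_simps image_iff) metis
  then show ?thesis
    using M.submodule_closed[OF A] by (simp add: RD_pure_modulo_def smult_eq eq_smult)
qed

lemma essential_image_imp_essential_modulo:
  assumes A: "submodule A R M" and ess: "essential R (\<pi> ` A) Q"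
  shows "essential_modulo R M (a_kernel M Q \<pi>) A"
  unfolding essential_modulo_def
proof
  let ?K = "a_kernel M Q \<pi>"
  fix m assume m: "m \<in> carrier M - ?K"
  let ?L = "(\<lambda>s. s \<odot>\<^bsub>Q\<^esub> \<pi> m) ` carrier R"
  have L: "submodule ?L R Q" using m by (intro N.submodule_ideal_smult M.R.oneideal) simp
  have "\<pi> m \<in> ?L" using m by (intro image_eqI[of _ _ "\<one>"]) auto
  moreover have "\<pi> m \<noteq> \<zero>\<^bsub>Q\<^esub>" using m by (simp add: a_kernel_def')
  ultimately have "?L \<inter> \<pi> ` A \<noteq> {\<zero>\<^bsub>Q\<^esub>}" using ess L unfolding essential_def by blast
  moreover have "\<zero>\<^bsub>Q\<^esub> \<in> ?L \<inter> \<pi> ` A"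
    using N.submodule_zero_closed[OF L] N.submodule_zero_closed[OF submodule_image[OF A]] by blast
  ultimately obtain y where "y \<in> ?L" "y \<in> \<pi> ` A" "y \<noteq> \<zero>\<^bsub>Q\<^esub>" by blast
  then obtain s a where s: "s \<in> carrier R" and a: "a \<in> A" "\<pi> a \<noteq> \<zero>\<^bsub>Q\<^esub>"
    and eq: "s \<odot>\<^bsub>Q\<^esub> \<pi> m = \<pi> a" by auto
  have "s \<odot>\<^bsub>M\<^esub> m \<ominus>\<^bsub>M\<^esub> a \<in> ?K"
    using hom_eq_iff[of "s \<odot>\<^bsub>M\<^esub> m" a] M.submodule_closed[OF A a(1)] m s eq by simp
  moreover have "a \<in> A - ?K" using a by (simp add: a_kernel_def')
  ultimately show "\<exists>s\<in>carrier R. \<exists>a\<in>A - ?K. s \<odot>\<^bsub>M\<^esub> m \<ominus>\<^bsub>M\<^esub> a \<in> ?K" using s by blast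
qed

lemma RD_essential_image:
  assumes A: "submodule A R M" and pure: "RD_pure_modulo R M (a_kernel M Q \<pi>) A"
    and maximal: "\<And>K. \<lbrakk>submodule K R M; a_kernel M Q \<pi> \<subseteq> K;
        K \<inter> A \<subseteq> a_kernel M Q \<pi>; RD_pure_modulo R M K A\<rbrakk>
      \<Longrightarrow> K = a_kernel M Q \<pi>"
  shows "RD_essential R (\<pi> ` A) Q"
  unfolding RD_essential_def RD_pure_image_iff[OF A]
proof (intro conjI pure allI impI)
  fix L assume "submodule L R Q \<and> L \<noteq> {\<zero>\<^bsub>Q\<^esub>}"
  then have L: "submodule L R Q" and "L \<noteq> {\<zero>\<^bsub>Q\<^esub>}" by auto
  interpret \<rho>: module_epimorphism R Q "quot_module Q L" "a_r_coset Q L"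
    by (rule quot_module_epimorphism[OF module_target L])
  interpret \<rho>\<pi>: module_epimorphism R M "quot_module Q L" "a_r_coset Q L \<circ> \<pi>"
    by (rule module_epimorphism_comp[OF module_epimorphism_axioms \<rho>.module_epimorphism_axioms])
  let ?K = "{x \<in> carrier M. \<pi> x \<in> L}"
  have kernel: "a_kernel M (quot_module Q L) (a_r_coset Q L \<circ> \<pi>) = ?K"
    using a_kernel_comp[of \<pi> M Q "quot_module Q L" "a_r_coset Q L"]
    by (simp add: image_eq a_kernel_quot_module[OF module_target L])
  have False
    if disjoint: "L \<inter> \<pi> ` A = {\<zero>\<^bsub>Q\<^esub>}"
      and pure_L: "RD_pure R ((\<lambda>a. L +>\<^bsub>Q\<^esub> a) ` \<pi> ` A) (quot_module Q L)"
  proof -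
    have "?K \<inter> A \<subseteq> a_kernel M Q \<pi>" using disjoint by (auto simp: a_kernel_def')
    moreover have "a_kernel M Q \<pi> \<subseteq> ?K"
      using N.submodule_zero_closed[OF L] by (auto simp: a_kernel_def')
    moreover have "RD_pure_modulo R M ?K A"
      using \<rho>\<pi>.RD_pure_image_iff[OF A] kernel pure_L by (simp add: image_comp)
    ultimately have "?K = a_kernel M Q \<pi>"
      using maximal[OF submodule_vimage[OF L]] by blast
    then have "x \<in> ?K \<longrightarrow> \<pi> x = \<zero>\<^bsub>Q\<^esub>" for x by (simp add: a_kernel_def')
    then have "L \<subseteq> {\<zero>\<^bsub>Q\<^esub>}" using N.submoduleE(1)[OF L] by (auto simp flip: image_eq)
    then show False
      using \<open>L \<noteq> {\<zero>\<^bsub>Q\<^esub>}\<close> N.submodule_zero_closed[OF L] by blast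
  qed
  then show "L \<inter> \<pi> ` A \<noteq> {\<zero>\<^bsub>Q\<^esub>} \<or> \<not> RD_pure R ((\<lambda>a. L +>\<^bsub>Q\<^esub> a) ` \<pi> ` A) (quot_module Q L)"
    by blast
qed

end

lemma exists_maximal_RD_pure_modulo:
  assumes M: "module R M" and N: "submodule N R M" and NA: "N \<subseteq> A"
    and pure: "RD_pure_modulo R M N A"
  obtains K where "submodule K R M" "K \<inter> A = N" "RD_pure_modulo R M K A"
    "\<And>K'. \<lbrakk>submodule K' R M; K \<subseteq> K'; K' \<inter> A = N; RD_pure_modulo R M K' A\<rbrakk> \<Longrightarrow> K' = K"
proof -
  interpret M: module R M by fact
  define \<K> where "\<K> = {K. submodule K R M \<and> K \<inter> A = N \<and> RD_pure_modulo R M K A}"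
  have "\<exists>K\<in>\<K>. \<forall>X\<in>\<K>. K \<subseteq> X \<longrightarrow> X = K"
  proof (rule subset_Zorn_nonempty)
    show "\<K> \<noteq> {}" using N NA pure by (auto simp: \<K>_def)
    fix C assume C: "C \<noteq> {}" and chain: "subset.chain \<K> C"
    have mem: "submodule X R M" "X \<inter> A = N" "RD_pure_modulo R M X A" if "X \<in> C" for X
      using chain that by (auto simp: subset.chain_def \<K>_def)
    have "X \<subseteq> Y \<or> Y \<subseteq> X" if "X \<in> C" "Y \<in> C" for X Y
      using chain that unfolding subset.chain_def by blast
    then have "submodule (\<Union>C) R M" using M.submodule_Union_chain[OF C mem(1)] by blast
    moreover have "\<Union>C \<inter> A = N" using C mem(2) by blast
    moreover have "RD_pure_modulo R M (\<Union>C) A"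
      using mem(3) unfolding RD_pure_modulo_def by blast
    ultimately show "\<Union>C \<in> \<K>" by (simp add: \<K>_def)
  qed
  then show thesis using that by (auto simp: \<K>_def)
qed

locale RD_essential_cring = cring R for R :: "('r,'c) ring_scheme" (structure) +
  fixes T :: "'t itself"
  assumes RD_essential_imp_essential:
    "\<lbrakk>module R B; submodule A R B; RD_essential R A B\<rbrakk> \<Longrightarrow> essential R A (B :: ('r, 't set) module)"
begin

text \<open>The map j only serves to realise \<open>M/K\<close> on the carrier type of the hypothesis.\<close>

lemma exists_essential_RD_pure_quotient:
  fixes M :: "('r,'m) module" and j :: "'m \<Rightarrow> 't"
  assumes M: "module R M" and A: "submodule A R M" and N: "submodule N R M" and NA: "N \<subseteq> A"
    and pure: "RD_pure_modulo R M N A" and j: "inj_on j (carrier M)"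
  obtains K where "submodule K R M" "K \<inter> A = N" "RD_pure_modulo R M K A" "essential_modulo R M K A"
proof -
  interpret M: module R M by fact
  obtain K where K: "submodule K R M" "K \<inter> A = N" "RD_pure_modulo R M K A"
    and maximal: "\<And>K'. \<lbrakk>submodule K' R M; K \<subseteq> K'; K' \<inter> A = N; RD_pure_modulo R M K' A\<rbrakk> \<Longrightarrow> K' = K"
    by (rule exists_maximal_RD_pure_modulo[OF M N NA pure]) blast
  interpret q: module_epimorphism R M "quot_module M K" "a_r_coset M K"
    by (rule quot_module_epimorphism[OF M K(1)])
  have "K +>\<^bsub>M\<^esub> m \<subseteq> carrier M" if "m \<in> carrier M" for m
    using M.M.a_r_coset_subset_G[OF M.submoduleE(1)[OF K(1)] that] .
  then have "inj_on ((`) j) (carrier (quot_module M K))"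
    using inj_on_image_eq_iff[OF j] by (auto simp: inj_on_def[of "(`) j"] simp flip: q.image_eq)
  note transport = q.transport_comp_epimorphism[OF this] q.a_kernel_transport_comp[OF this]
  let ?Q = "transport_module ((`) j) (quot_module M K)" and ?\<pi> = "(`) j \<circ> a_r_coset M K"
  interpret \<pi>: module_epimorphism R M ?Q ?\<pi> by (rule transport(1))
  have kernel: "a_kernel M ?Q ?\<pi> = K"
    unfolding transport(2) by (rule a_kernel_quot_module[OF M K(1)])
  have "RD_essential R (?\<pi> ` A) ?Q"
  proof (rule \<pi>.RD_essential_image[OF A])
    show "RD_pure_modulo R M (a_kernel M ?Q ?\<pi>) A" unfolding kernel by (rule K(3))
    fix K' assume "submodule K' R M" "a_kernel M ?Q ?\<pi> \<subseteq> K'" "K' \<inter> A \<subseteq> a_kernel M ?Q ?\<pi>"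
      "RD_pure_modulo R M K' A"
    then show "K' = a_kernel M ?Q ?\<pi>" unfolding kernel using K(2) by (intro maximal) auto
  qed
  then have "essential R (?\<pi> ` A) ?Q"
    by (rule RD_essential_imp_essential[OF \<pi>.module_target \<pi>.submodule_image[OF A]])
  then have "essential_modulo R M K A"
    using \<pi>.essential_image_imp_essential_modulo[OF A] kernel by simp
  then show thesis by (rule that[OF K])
qed

end

section \<open>Essential extensions and maximal ideals\<close>

locale cring_maximal = cring R + P: maximalideal P R
  for R :: "('r,'c) ring_scheme" (structure) and P
begin

lemma one_notin_P: "\<one> \<notin> P"
  using P.I_notcarr P.one_imp_carrier by blast

lemma mult_notin_P: "\<lbrakk>s \<in> carrier R - P; t \<in> carrier R - P\<rbrakk> \<Longrightarrow> s \<otimes> t \<in> carrier R - P"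
  using primeideal.I_prime[OF maximalideal_prime[OF P.is_maximalideal]] by blast

lemma one_minus_notin_P:
  assumes q: "q \<in> P"
  shows "\<one> \<ominus> q \<in> carrier R - P"
proof -
  have "(\<one> \<ominus> q) \<oplus> q = \<one>" using P.Icarr[OF q] by algebra
  then show ?thesis using P.a_closed[OF _ q] one_notin_P P.Icarr[OF q] by fastforce
qed

lemma inverse_mod_P:
  assumes s: "s \<in> carrier R - P"
  obtains t q where "t \<in> carrier R" "q \<in> P" "t \<otimes> s = \<one> \<oplus> q"
proof -
  have sR: "s \<in> carrier R" using s by blast
  interpret J: ideal "P <+>\<^bsub>R\<^esub> PIdl s" R
    by (rule add_ideals[OF P.is_ideal cgenideal_ideal[OF sR]])
  have "P \<union> PIdl s \<subseteq> P <+>\<^bsub>R\<^esub> PIdl s"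
    using union_genideal[OF P.is_ideal cgenideal_ideal[OF sR]] genideal_self[of "P \<union> PIdl s"]
      P.a_subset ideal.Icarr[OF cgenideal_ideal[OF sR]] by blast
  then have "P <+>\<^bsub>R\<^esub> PIdl s = carrier R"
    using P.I_maximal[OF J.is_ideal _ J.a_subset] cgenideal_self[OF sR] s by blast
  then obtain p x where px: "p \<in> P" "x \<in> carrier R" "\<one> = p \<oplus> x \<otimes> s"
    using one_closed unfolding set_add_def' cgenideal_def by blast
  have "x \<otimes> s = (p \<oplus> x \<otimes> s) \<oplus> \<ominus> p" using sR px(2) P.Icarr[OF px(1)] by algebra
  then have "x \<otimes> s = \<one> \<oplus> \<ominus> p" using px(3) by simp
  then show thesis using that[of x "\<ominus> p"] px by simp
qed

lemma exists_solution_mod_P: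
  assumes s: "s \<in> carrier R - P" and c: "c \<in> carrier R"
  shows "\<exists>d\<in>carrier R. c \<ominus> s \<otimes> d \<in> P"
proof -
  obtain t q where t: "t \<in> carrier R" "q \<in> P" "t \<otimes> s = \<one> \<oplus> q" using inverse_mod_P[OF s] .
  have sR: "s \<in> carrier R" using s by blast
  have "c \<ominus> s \<otimes> (t \<otimes> c) = c \<ominus> (t \<otimes> s) \<otimes> c" using sR t(1) c by algebra
  also have "\<dots> = c \<otimes> \<ominus> q" unfolding t(3) using c P.Icarr[OF t(2)] by algebra
  also have "\<dots> \<in> P" using P.I_l_closed[OF P.a_inv_closed[OF t(2)] c] .
  finally show ?thesis using t(1) c by blast
qed

lemma essential_modulo_socle:
  assumes M: "module R M" and A: "submodule A R M" and K: "submodule K R M"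
    and ess: "essential_modulo R M K A"
    and y: "y \<in> carrier M" and Py: "\<And>q. q \<in> P \<Longrightarrow> q \<odot>\<^bsub>M\<^esub> y \<in> K"
  shows "\<exists>a\<in>A. y \<ominus>\<^bsub>M\<^esub> a \<in> K"
proof (cases "y \<in> K")
  case True
  interpret M: module R M by fact
  show ?thesis
    using True y M.submodule_zero_closed[OF A] by (intro bexI[of _ "\<zero>\<^bsub>M\<^esub>"]) simp_all
next
  case False
  interpret M: module R M by fact
  obtain s a where s: "s \<in> carrier R" and a: "a \<in> A" "a \<notin> K" and sy: "s \<odot>\<^bsub>M\<^esub> y \<ominus>\<^bsub>M\<^esub> a \<in> K"
    using essential_moduloD[OF ess y False] .
  have aM: "a \<in> carrier M" using M.submodule_closed[OF A a(1)] .
  have "s \<notin> P"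
    using Py[of s] M.submodule_minus_mem_iff[OF K _ aM sy] a(2) s y by auto
  then obtain t q where t: "t \<in> carrier R" "q \<in> P" "t \<otimes> s = \<one> \<oplus> q"
    using inverse_mod_P[of s] s by blast
  have qR: "q \<in> carrier R" using P.Icarr[OF t(2)] .
  have "t \<odot>\<^bsub>M\<^esub> (s \<odot>\<^bsub>M\<^esub> y \<ominus>\<^bsub>M\<^esub> a) = (t \<otimes> s) \<odot>\<^bsub>M\<^esub> y \<ominus>\<^bsub>M\<^esub> t \<odot>\<^bsub>M\<^esub> a"
    using s t(1) aM y by (simp add: M.smult_r_diff M.smult_assoc1)
  also have "(t \<otimes> s) \<odot>\<^bsub>M\<^esub> y = q \<odot>\<^bsub>M\<^esub> y \<oplus>\<^bsub>M\<^esub> y"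
    unfolding t(3) using qR y by (simp add: M.smult_l_distr M.M.a_comm)
  finally have "q \<odot>\<^bsub>M\<^esub> y \<oplus>\<^bsub>M\<^esub> (y \<ominus>\<^bsub>M\<^esub> t \<odot>\<^bsub>M\<^esub> a) \<in> K"
    using M.submoduleE(4)[OF K t(1) sy] t(1) qR aM y by (simp add: M.M.minus_eq M.M.a_assoc)
  then have "(q \<odot>\<^bsub>M\<^esub> y \<oplus>\<^bsub>M\<^esub> (y \<ominus>\<^bsub>M\<^esub> t \<odot>\<^bsub>M\<^esub> a)) \<ominus>\<^bsub>M\<^esub> q \<odot>\<^bsub>M\<^esub> y \<in> K"
    by (rule M.submodule_minus_closed[OF K _ Py[OF t(2)]])
  then have "y \<ominus>\<^bsub>M\<^esub> t \<odot>\<^bsub>M\<^esub> a \<in> K"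
    using t(1) qR aM y by (simp add: M.M.minus_eq M.M.a_ac M.M.r_neg1 M.M.r_neg2)
  then show ?thesis using M.submoduleE(4)[OF A t(1) a(1)] by blast
qed

end

section \<open>Local T-nilpotence\<close>

context cring
begin

definition eventually_in :: "('i \<Rightarrow> 'a set) \<Rightarrow> 'i filter \<Rightarrow> ('i \<Rightarrow> 'a) set" where
  "eventually_in I F = {f \<in> carrier (fun_module R). \<forall>\<^sub>F i in F. f i \<in> I i}"

lemma eventually_inD: "f \<in> eventually_in I F \<Longrightarrow> f i \<in> carrier R"
  by (auto simp: eventually_in_def)

lemma submodule_eventually_in:
  fixes I :: "'i \<Rightarrow> 'a set"
  assumes "\<And>i. ideal (I i) R"
  shows "submodule (eventually_in I F) R (fun_module R)"
proof -
  interpret M: module R "fun_module R :: ('a, 'i \<Rightarrow> 'a) module" by (rule module_fun_module)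
  interpret I: ideal "I i" R for i by (rule assms)
  show ?thesis
  proof (rule M.submoduleI)
    show "eventually_in I F \<subseteq> carrier (fun_module R)" by (auto simp: eventually_in_def)
    show "\<zero>\<^bsub>fun_module R\<^esub> \<in> eventually_in I F" by (simp add: eventually_in_def)
    show "\<ominus>\<^bsub>fun_module R\<^esub> f \<in> eventually_in I F" if "f \<in> eventually_in I F" for f
      using that by (auto simp: eventually_in_def fun_module_uminus elim: eventually_mono)
    show "f \<oplus>\<^bsub>fun_module R\<^esub> g \<in> eventually_in I F"
      if "f \<in> eventually_in I F" "g \<in> eventually_in I F" for f g
      using that M.M.a_closed[of f g]
      by (auto simp: eventually_in_def fadd_def elim: eventually_elim2)
    show "c \<odot>\<^bsub>fun_module R\<^esub> f \<in> eventually_in I F"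
      if "c \<in> carrier R" "f \<in> eventually_in I F" for c f
      using that M.smult_closed[of c f] I.I_l_closed
      by (auto simp: eventually_in_def fscale_def elim: eventually_mono)
  qed
qed

lemma RD_pure_modulo_eventually_in:
  assumes I: "\<And>i. ideal (I i) R"
  shows "RD_pure_modulo R (fun_module R) (eventually_in I G) (eventually_in I F)"
  unfolding RD_pure_modulo_def
proof (intro ballI impI)
  interpret I: ideal "I i" R for i by (rule assms)
  fix c m a
  assume c: "c \<in> carrier R" and m: "m \<in> carrier (fun_module R)" and a: "a \<in> eventually_in I F"
    and G: "c \<odot>\<^bsub>fun_module R\<^esub> m \<ominus>\<^bsub>fun_module R\<^esub> a \<in> eventually_in I G"
  have closed: "m i \<in> carrier R" "a i \<in> carrier R" for i
    using m eventually_inD[OF a] by auto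
  define m' where "m' i = (if a i \<in> I i then \<zero> else m i)" for i
  note minus = fun_module_minus[unfolded fminus_def]
  have "m' \<in> eventually_in I F"
    using a closed by (auto simp: eventually_in_def m'_def elim: eventually_mono)
  moreover have "a \<ominus>\<^bsub>fun_module R\<^esub> c \<odot>\<^bsub>fun_module R\<^esub> m' \<in> eventually_in I G"
  proof -
    have "\<forall>\<^sub>F i in G. c \<otimes> m i \<ominus> a i \<in> I i"
      using G c closed by (simp add: eventually_in_def minus fscale_def)
    then have "\<forall>\<^sub>F i in G. a i \<ominus> c \<otimes> m' i \<in> I i"
    proof (rule eventually_mono)
      fix i assume i: "c \<otimes> m i \<ominus> a i \<in> I i"
      have "\<ominus> (c \<otimes> m i \<ominus> a i) = a i \<ominus> c \<otimes> m i" using c closed[of i] by algebra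
      then have "a i \<ominus> c \<otimes> m i \<in> I i" using I.a_inv_closed[OF i] by simp
      then show "a i \<ominus> c \<otimes> m' i \<in> I i" using c closed[of i] by (simp add: m'_def minus_eq)
    qed
    then show ?thesis using c closed by (simp add: eventually_in_def minus fscale_def m'_def)
  qed
  ultimately show "\<exists>a'\<in>eventually_in I F. a \<ominus>\<^bsub>fun_module R\<^esub> c \<odot>\<^bsub>fun_module R\<^esub> a' \<in> eventually_in I G"
    by blast
qed

lemma ideal_mult_image:
  assumes I: "ideal I R" and a: "a \<in> carrier R"
  shows "ideal ((\<otimes>) a ` I) R"
proof (rule idealI[OF ring_axioms])
  interpret I: ideal I R by fact
  show "subgroup ((\<otimes>) a ` I) (add_monoid R)"
  proof (rule add.subgroupI)
    show "(\<otimes>) a ` I \<subseteq> carrier R" using a by auto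
    show "(\<otimes>) a ` I \<noteq> {}" using I.zero_closed by blast
    show "\<ominus> x \<in> (\<otimes>) a ` I" if "x \<in> (\<otimes>) a ` I" for x
      using that a by (auto simp flip: r_minus)
    show "x \<oplus> y \<in> (\<otimes>) a ` I" if "x \<in> (\<otimes>) a ` I" "y \<in> (\<otimes>) a ` I" for x y
      using that a I.a_closed by (auto simp flip: r_distr)
  qed
  show left: "c \<otimes> x \<in> (\<otimes>) a ` I" if "x \<in> (\<otimes>) a ` I" "c \<in> carrier R" for x c
    using that a I.I_l_closed by (auto simp: m_lcomm)
  show "x \<otimes> c \<in> (\<otimes>) a ` I" if "x \<in> (\<otimes>) a ` I" "c \<in> carrier R" for x c
    using that a I.I_r_closed by (auto simp: m_assoc)
qed

lemma finprod_lessThan_split: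
  fixes p :: "nat \<Rightarrow> 'a"
  assumes "\<And>n. p n \<in> carrier R" "m \<le> n"
  shows "finprod R p {..<n} = finprod R p {..<m} \<otimes> finprod R p {m..<n}"
proof -
  have "{..<n} = {..<m} \<union> {m..<n}" using assms(2) by auto
  moreover have "finprod R p ({..<m} \<union> {m..<n}) = finprod R p {..<m} \<otimes> finprod R p {m..<n}"
    by (rule finprod_Un_disjoint) (use assms(1) in auto)
  ultimately show ?thesis by simp
qed

lemma cofinitely_divisible:
  fixes I :: "nat \<Rightarrow> 'a set" and r :: "nat \<Rightarrow> 'a"
  assumes I: "\<And>i. ideal (I i) R" and r: "r \<in> UNIV \<rightarrow> carrier R" and s: "s \<in> carrier R"
    and dvd: "\<And>k. n < k \<Longrightarrow> \<exists>y\<in>carrier R. r k = s \<otimes> y"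
  obtains y b where "y \<in> carrier (fun_module R)" "b \<in> eventually_in I cofinite" "b n = r n"
    "s \<odot>\<^bsub>fun_module R\<^esub> y = r \<ominus>\<^bsub>fun_module R\<^esub> b"
proof -
  interpret I: ideal "I i" R for i by (rule I)
  obtain z where z: "\<And>k. n < k \<Longrightarrow> z k \<in> carrier R \<and> r k = s \<otimes> z k"
    using dvd by metis
  define y where "y k = (if k \<le> n then \<zero> else z k)" for k
  define b where "b k = (if k \<le> n then r k else \<zero>)" for k
  have yb: "y \<in> carrier (fun_module R)" "b \<in> carrier (fun_module R)"
    using z r by (auto simp: y_def b_def)
  have "finite {k. b k \<notin> I k}"
    by (rule finite_subset[of _ "{..n}"]) (auto simp: b_def)
  then have b: "b \<in> eventually_in I cofinite"
    using yb(2) by (simp add: eventually_in_def eventually_cofinite)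
  have "r k \<in> carrier R" for k using r by auto
  then have "s \<odot>\<^bsub>fun_module R\<^esub> y = r \<ominus>\<^bsub>fun_module R\<^esub> b"
    using z r yb(2) s
    by (auto simp: fun_module_minus fminus_def fscale_def y_def b_def minus_eq r_neg)
  then show thesis using that yb(1) b by (simp add: b_def)
qed

text \<open>Changing the entries up to n makes r, and then by RD-purity also a, a multiple of s.\<close>

lemma cofinite_approximation_entry:
  fixes I :: "nat \<Rightarrow> 'a set" and r a :: "nat \<Rightarrow> 'a"
  assumes I: "\<And>i. ideal (I i) R" and K: "submodule K R (fun_module R)"
    and disjoint: "K \<inter> eventually_in I cofinite = eventually_in I (principal UNIV)"
    and pure: "RD_pure_modulo R (fun_module R) K (eventually_in I cofinite)"
    and r: "r \<in> UNIV \<rightarrow> carrier R" and a: "a \<in> eventually_in I cofinite"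
    and ra: "r \<ominus>\<^bsub>fun_module R\<^esub> a \<in> K"
    and s: "s \<in> I n" and dvd: "\<And>k. n < k \<Longrightarrow> \<exists>y\<in>carrier R. r k = s \<otimes> y"
  shows "a n \<ominus> r n \<in> I n"
proof -
  let ?M = "fun_module R :: ('a, nat \<Rightarrow> 'a) module" and ?A = "eventually_in I cofinite"
  interpret M: module R ?M by (rule module_fun_module)
  interpret I: ideal "I n" R by (rule I)
  have A: "submodule ?A R ?M" by (rule submodule_eventually_in[OF I])
  note minus = fun_module_minus[unfolded fminus_def]
  have sR: "s \<in> carrier R" using s by simp
  obtain y b where y: "y \<in> carrier ?M" and b: "b \<in> ?A" "b n = r n"
    and sy: "s \<odot>\<^bsub>?M\<^esub> y = r \<ominus>\<^bsub>?M\<^esub> b"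
    by (rule cofinitely_divisible[where n = n, OF I r sR dvd]) blast+
  have closed: "r k \<in> carrier R" "a k \<in> carrier R" "b k \<in> carrier R" for k
    using r eventually_inD[OF a] eventually_inD[OF b(1)] by auto
  have ab: "a \<ominus>\<^bsub>?M\<^esub> b \<in> ?A" by (rule M.submodule_minus_closed[OF A a b(1)])
  have "(r k \<ominus> b k) \<ominus> (a k \<ominus> b k) = r k \<ominus> a k" for k using closed[of k] by algebra
  then have "s \<odot>\<^bsub>?M\<^esub> y \<ominus>\<^bsub>?M\<^esub> (a \<ominus>\<^bsub>?M\<^esub> b) = r \<ominus>\<^bsub>?M\<^esub> a"
    unfolding sy using closed by (simp add: minus Pi_iff)
  then obtain a' where a': "a' \<in> ?A" "a \<ominus>\<^bsub>?M\<^esub> b \<ominus>\<^bsub>?M\<^esub> s \<odot>\<^bsub>?M\<^esub> a' \<in> K"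
    using RD_pure_moduloD[OF pure sR y ab] ra by metis
  have a'R: "a' k \<in> carrier R" for k using eventually_inD[OF a'(1)] .
  have "a \<ominus>\<^bsub>?M\<^esub> b \<ominus>\<^bsub>?M\<^esub> s \<odot>\<^bsub>?M\<^esub> a' \<in> eventually_in I (principal UNIV)"
    using M.submodule_minus_closed[OF A ab M.submoduleE(4)[OF A sR a'(1)]] a'(2) disjoint by blast
  then have "(a n \<ominus> r n) \<ominus> s \<otimes> a' n \<in> I n"
    using sR closed a'R b(2)
    by (simp add: minus eventually_in_def eventually_principal fscale_def Pi_iff) metis
  then have "((a n \<ominus> r n) \<ominus> s \<otimes> a' n) \<oplus> s \<otimes> a' n \<in> I n"
    using I.a_closed I.I_r_closed[OF s a'R] by simp
  moreover have "((a n \<ominus> r n) \<ominus> s \<otimes> a' n) \<oplus> s \<otimes> a' n = a n \<ominus> r n"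
    using closed[of n] a'R[of n] sR by algebra
  ultimately show ?thesis by simp
qed

end

locale RD_essential_maximal = cring_maximal R P + RD_essential_cring R T
  for R :: "('r,'c) ring_scheme" (structure) and P and T :: "'t itself"

context RD_essential_maximal
begin

lemma exists_cofinite_approximation:
  fixes r :: "nat \<Rightarrow> 'r" and \<iota> :: "(nat \<Rightarrow> 'r) \<Rightarrow> 't"
  defines "I \<equiv> \<lambda>n. (\<otimes>) (r n) ` P"
  assumes r: "r \<in> UNIV \<rightarrow> carrier R"
    and dvd: "\<And>m n. m \<le> n \<Longrightarrow> \<exists>y\<in>carrier R. r n = r m \<otimes> y"
    and Suc: "\<And>n. r (Suc n) \<in> I n" and \<iota>: "inj \<iota>"
  obtains a where "a \<in> eventually_in I cofinite" "\<And>n. a n \<ominus> r n \<in> I n"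
proof -
  let ?M = "fun_module R :: ('r, nat \<Rightarrow> 'r) module"
  let ?A = "eventually_in I cofinite" and ?N = "eventually_in I (principal UNIV)"
  interpret M: module R ?M by (rule module_fun_module)
  have rR: "r n \<in> carrier R" for n using r by auto
  have I: "ideal (I n) R" for n unfolding I_def by (rule ideal_mult_image[OF P.is_ideal rR])
  have A: "submodule ?A R ?M" and N: "submodule ?N R ?M"
    by (rule submodule_eventually_in[OF I])+
  have "?N \<subseteq> ?A" by (auto simp: eventually_in_def eventually_principal)
  then obtain K where K: "submodule K R ?M" and KA: "K \<inter> ?A = ?N"
    and pure: "RD_pure_modulo R ?M K ?A" and ess: "essential_modulo R ?M K ?A"
    using exists_essential_RD_pure_quotient[OF M.module_axioms A N _
        RD_pure_modulo_eventually_in[OF I]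
        inj_on_subset[OF \<iota> subset_UNIV]] by blast
  have Pr: "q \<odot>\<^bsub>?M\<^esub> r \<in> ?N" if q: "q \<in> P" for q
  proof -
    have "q \<otimes> r n \<in> I n" for n
      unfolding I_def using q by (intro image_eqI[of _ _ q]) (simp_all add: P.Icarr rR m_comm)
    then show ?thesis using P.Icarr[OF q] rR
      by (simp add: eventually_in_def eventually_principal fscale_def)
  qed
  have "\<exists>a\<in>?A. r \<ominus>\<^bsub>?M\<^esub> a \<in> K"
    by (rule essential_modulo_socle[OF M.module_axioms A K ess]) (use r Pr KA in auto)
  then obtain a where a: "a \<in> ?A" and ra: "r \<ominus>\<^bsub>?M\<^esub> a \<in> K" by blast
  have "a n \<ominus> r n \<in> I n" for n
    using cofinite_approximation_entry[OF I K KA pure r a ra Suc] dvd[of "Suc n"] by simp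
  then show thesis using that a by blast
qed

lemma locally_T_nilpotent:
  fixes p :: "nat \<Rightarrow> 'r" and \<iota> :: "(nat \<Rightarrow> 'r) \<Rightarrow> 't"
  assumes p: "\<And>n. p n \<in> P" and \<iota>: "inj \<iota>"
  shows "\<exists>n. \<exists>s\<in>carrier R - P. s \<otimes> finprod R p {..<n} = \<zero>"
proof -
  have pR: "p n \<in> carrier R" for n using P.Icarr[OF p] .
  define r where "r n = finprod R p {..<n}" for n
  have r: "r \<in> UNIV \<rightarrow> carrier R" by (auto simp: r_def pR intro!: finprod_closed)
  have split: "r n = r m \<otimes> finprod R p {m..<n}" if "m \<le> n" for m n
    unfolding r_def by (rule finprod_lessThan_split[OF pR that])
  have "r (Suc n) = r n \<otimes> p n" for n
    using split[of n "Suc n"] pR by simp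
  then have Suc: "r (Suc n) \<in> (\<otimes>) (r n) ` P" for n using p by auto
  have "\<exists>y\<in>carrier R. r n = r m \<otimes> y" if "m \<le> n" for m n
    using split[OF that] by (intro bexI) (auto simp: pR intro!: finprod_closed)
  then obtain a where a: "a \<in> eventually_in (\<lambda>n. (\<otimes>) (r n) ` P) cofinite"
    and ar: "\<And>n. a n \<ominus> r n \<in> (\<otimes>) (r n) ` P"
    using exists_cofinite_approximation[OF r _ Suc \<iota>] by blast
  from a have "finite {n. a n \<notin> (\<otimes>) (r n) ` P}" by (simp add: eventually_in_def eventually_cofinite)
  then obtain n where n: "a n \<in> (\<otimes>) (r n) ` P"
    using infinite_UNIV_nat by (metis (mono_tags, lifting) UNIV_eq_I mem_Collect_eq)
  have rR: "r n \<in> carrier R" and aR: "a n \<in> carrier R" using r eventually_inD[OF a] by auto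
  interpret I: ideal "(\<otimes>) (r n) ` P" R by (rule ideal_mult_image[OF P.is_ideal rR])
  have "a n \<oplus> \<ominus> (a n \<ominus> r n) \<in> (\<otimes>) (r n) ` P" using I.a_closed[OF n I.a_inv_closed[OF ar]] .
  moreover have "a n \<oplus> \<ominus> (a n \<ominus> r n) = r n" using aR rR by algebra
  ultimately obtain q where q: "q \<in> P" "r n = r n \<otimes> q" by auto
  have "(\<one> \<ominus> q) \<otimes> r n = r n \<ominus> r n \<otimes> q" using P.Icarr[OF q(1)] rR by algebra
  also have "\<dots> = \<zero>" unfolding q(2)[symmetric] using rR by (simp add: minus_eq r_neg)
  finally show ?thesis using one_minus_notin_P[OF q(1)] unfolding r_def by blast
qed

end

section \<open>Local principality\<close>

definition prod_module :: "('r,'a) module \<Rightarrow> ('r,'b) module \<Rightarrow> ('r, 'a \<times> 'b) module" where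
  "prod_module U V = \<lparr>carrier = carrier U \<times> carrier V,
     mult = (\<lambda>_ _. (\<zero>\<^bsub>U\<^esub>, \<zero>\<^bsub>V\<^esub>)), one = (\<zero>\<^bsub>U\<^esub>, \<zero>\<^bsub>V\<^esub>), zero = (\<zero>\<^bsub>U\<^esub>, \<zero>\<^bsub>V\<^esub>),
     add = (\<lambda>x y. (fst x \<oplus>\<^bsub>U\<^esub> fst y, snd x \<oplus>\<^bsub>V\<^esub> snd y)),
     smult = (\<lambda>c x. (c \<odot>\<^bsub>U\<^esub> fst x, c \<odot>\<^bsub>V\<^esub> snd x))\<rparr>"

lemma prod_module_simps [simp]:
  "carrier (prod_module U V) = carrier U \<times> carrier V"
  "\<zero>\<^bsub>prod_module U V\<^esub> = (\<zero>\<^bsub>U\<^esub>, \<zero>\<^bsub>V\<^esub>)"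
  "(x, y) \<oplus>\<^bsub>prod_module U V\<^esub> (x', y') = (x \<oplus>\<^bsub>U\<^esub> x', y \<oplus>\<^bsub>V\<^esub> y')"
  "c \<odot>\<^bsub>prod_module U V\<^esub> (x, y) = (c \<odot>\<^bsub>U\<^esub> x, c \<odot>\<^bsub>V\<^esub> y)"
  by (simp_all add: prod_module_def)

lemma module_prod_module:
  assumes "module R U" "module R V"
  shows "module R (prod_module U V)"
proof -
  interpret U: module R U by fact
  interpret V: module R V by fact
  show ?thesis
  proof (rule moduleI)
    show "abelian_group (prod_module U V)"
    proof (rule abelian_groupI)
      fix x assume "x \<in> carrier (prod_module U V)"
      then show "\<exists>y\<in>carrier (prod_module U V). y \<oplus>\<^bsub>prod_module U V\<^esub> x = \<zero>\<^bsub>prod_module U V\<^esub>"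
        by (intro bexI[of _ "(\<ominus>\<^bsub>U\<^esub> fst x, \<ominus>\<^bsub>V\<^esub> snd x)"]) (auto simp: U.M.l_neg V.M.l_neg)
    qed (auto simp: U.M.a_ac V.M.a_ac)
  qed (auto simp: U.R.is_cring U.smult_l_distr V.smult_l_distr
      U.smult_r_distr V.smult_r_distr U.smult_assoc1 V.smult_assoc1)
qed

lemma prod_module_minus:
  assumes "module R U" "module R V"
    and x: "x \<in> carrier U" "x' \<in> carrier U" and y: "y \<in> carrier V" "y' \<in> carrier V"
  shows "(x, y) \<ominus>\<^bsub>prod_module U V\<^esub> (x', y') = (x \<ominus>\<^bsub>U\<^esub> x', y \<ominus>\<^bsub>V\<^esub> y')"
proof -
  interpret U: module R U by fact
  interpret V: module R V by fact
  interpret M: module R "prod_module U V" by (rule module_prod_module) fact+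
  have "\<ominus>\<^bsub>prod_module U V\<^esub> (x', y') = (\<ominus>\<^bsub>U\<^esub> x', \<ominus>\<^bsub>V\<^esub> y')"
    by (rule M.M.minus_equality) (use x y in \<open>auto simp: U.M.l_neg V.M.l_neg\<close>)
  then show ?thesis by (simp add: M.M.minus_eq U.M.minus_eq V.M.minus_eq)
qed

context cring_maximal
begin

definition locally_dvd :: "'r \<Rightarrow> 'r \<Rightarrow> bool" where
  "locally_dvd a b \<longleftrightarrow> (\<exists>t\<in>carrier R - P. \<exists>c\<in>carrier R. t \<otimes> b = a \<otimes> c)"

lemma locally_dvdI:
  "\<lbrakk>t \<in> carrier R - P; c \<in> carrier R; t \<otimes> b = a \<otimes> c\<rbrakk> \<Longrightarrow> locally_dvd a b"
  unfolding locally_dvd_def by blast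

lemma locally_dvd_trans:
  assumes abc: "a \<in> carrier R" "b \<in> carrier R" "c \<in> carrier R"
    and "locally_dvd a b" "locally_dvd b c"
  shows "locally_dvd a c"
proof -
  obtain s x t y where s: "s \<in> carrier R - P" "x \<in> carrier R" "s \<otimes> b = a \<otimes> x"
    and t: "t \<in> carrier R - P" "y \<in> carrier R" "t \<otimes> c = b \<otimes> y"
    using assms(4,5) unfolding locally_dvd_def by blast
  have "(s \<otimes> t) \<otimes> c = (s \<otimes> b) \<otimes> y" using s(1) t abc by (simp add: m_assoc)
  also have "\<dots> = a \<otimes> (x \<otimes> y)" using s t(2) abc by (simp add: m_assoc)
  finally show ?thesis
    using mult_notin_P[OF s(1) t(1)] s(2) t(2) by (intro locally_dvdI[of "s \<otimes> t" "x \<otimes> y"]) auto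
qed

lemma RD_pure_modulo_ideal_smult:
  assumes M: "module R M" and z: "z \<in> carrier M"
    and indivisible: "\<And>r t m. \<lbrakk>r \<in> P; t \<in> carrier R - P; m \<in> carrier M\<rbrakk> \<Longrightarrow> t \<odot>\<^bsub>M\<^esub> z \<noteq> r \<odot>\<^bsub>M\<^esub> m"
  shows "RD_pure_modulo R M ((\<lambda>c. c \<odot>\<^bsub>M\<^esub> z) ` P) ((\<lambda>c. c \<odot>\<^bsub>M\<^esub> z) ` carrier R)"
  unfolding RD_pure_modulo_def
proof (intro ballI impI)
  interpret M: module R M by fact
  let ?N = "(\<lambda>c. c \<odot>\<^bsub>M\<^esub> z) ` P" and ?A = "(\<lambda>c. c \<odot>\<^bsub>M\<^esub> z) ` carrier R"
  fix r m x
  assume r: "r \<in> carrier R" and m: "m \<in> carrier M" and "x \<in> ?A" and "r \<odot>\<^bsub>M\<^esub> m \<ominus>\<^bsub>M\<^esub> x \<in> ?N"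
  then obtain c q where c: "c \<in> carrier R" "x = c \<odot>\<^bsub>M\<^esub> z"
    and q: "q \<in> P" "r \<odot>\<^bsub>M\<^esub> m \<ominus>\<^bsub>M\<^esub> c \<odot>\<^bsub>M\<^esub> z = q \<odot>\<^bsub>M\<^esub> z" by blast
  show "\<exists>a'\<in>?A. x \<ominus>\<^bsub>M\<^esub> r \<odot>\<^bsub>M\<^esub> a' \<in> ?N"
  proof (cases "r \<in> P")
    case True
    have "q \<oplus> c \<in> P"
    proof (rule ccontr)
      assume "q \<oplus> c \<notin> P"
      moreover have "(q \<oplus> c) \<odot>\<^bsub>M\<^esub> z = (r \<odot>\<^bsub>M\<^esub> m \<ominus>\<^bsub>M\<^esub> c \<odot>\<^bsub>M\<^esub> z) \<oplus>\<^bsub>M\<^esub> c \<odot>\<^bsub>M\<^esub> z"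
        unfolding q(2) using P.Icarr[OF q(1)] c(1) z by (simp add: M.smult_l_distr)
      then have "(q \<oplus> c) \<odot>\<^bsub>M\<^esub> z = r \<odot>\<^bsub>M\<^esub> m"
        using r m c(1) z by (simp add: M.M.minus_eq M.M.a_assoc M.M.l_neg)
      ultimately show False using indivisible[OF True _ m, of "q \<oplus> c"] P.Icarr[OF q(1)] c(1) by simp
    qed
    then have "(q \<oplus> c) \<oplus> \<ominus> q \<in> P" using P.a_closed[OF _ P.a_inv_closed[OF q(1)]] by blast
    moreover have "(q \<oplus> c) \<oplus> \<ominus> q = c" using P.Icarr[OF q(1)] c(1) by algebra
    ultimately have "x \<ominus>\<^bsub>M\<^esub> r \<odot>\<^bsub>M\<^esub> (\<zero> \<odot>\<^bsub>M\<^esub> z) \<in> ?N" using c r z by simp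
    then show ?thesis by blast
  next
    case False
    then obtain d where d: "d \<in> carrier R" "c \<ominus> r \<otimes> d \<in> P"
      using exists_solution_mod_P[of r c] r c(1) by blast
    then have "(c \<ominus> r \<otimes> d) \<odot>\<^bsub>M\<^esub> z \<in> ?N" by blast
    then have "x \<ominus>\<^bsub>M\<^esub> r \<odot>\<^bsub>M\<^esub> (d \<odot>\<^bsub>M\<^esub> z) \<in> ?N"
      using r d(1) c z by (simp add: M.smult_l_diff M.smult_assoc1)
    then show ?thesis using d(1) by blast
  qed
qed

lemma essential_RD_pure_semisimple:
  assumes M: "module R M" and K: "submodule K R M" and A: "submodule A R M"
    and pure: "RD_pure_modulo R M K A" and ess: "essential_modulo R M K A"
    and PA: "\<And>q a. \<lbrakk>q \<in> P; a \<in> A\<rbrakk> \<Longrightarrow> q \<odot>\<^bsub>M\<^esub> a \<in> K"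
    and q: "q \<in> P" and m: "m \<in> carrier M"
  shows "q \<odot>\<^bsub>M\<^esub> m \<in> K"
proof (rule ccontr)
  interpret M: module R M by fact
  assume "q \<odot>\<^bsub>M\<^esub> m \<notin> K"
  moreover have "q \<odot>\<^bsub>M\<^esub> m \<in> carrier M" using P.Icarr[OF q] m by simp
  ultimately obtain s a where s: "s \<in> carrier R" and a: "a \<in> A" "a \<notin> K"
    and "s \<odot>\<^bsub>M\<^esub> (q \<odot>\<^bsub>M\<^esub> m) \<ominus>\<^bsub>M\<^esub> a \<in> K"
    using essential_moduloD[OF ess] by metis
  then have "(s \<otimes> q) \<odot>\<^bsub>M\<^esub> m \<ominus>\<^bsub>M\<^esub> a \<in> K" using P.Icarr[OF q] m by (simp add: M.smult_assoc1)
  then obtain a' where a': "a' \<in> A" "a \<ominus>\<^bsub>M\<^esub> (s \<otimes> q) \<odot>\<^bsub>M\<^esub> a' \<in> K"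
    using RD_pure_moduloD[OF pure _ m a(1), of "s \<otimes> q"] s P.Icarr[OF q] by auto
  have sq: "s \<otimes> q \<in> P" using P.I_l_closed[OF q s] .
  have "a \<in> carrier M" "(s \<otimes> q) \<odot>\<^bsub>M\<^esub> a' \<in> carrier M"
    using M.submodule_closed[OF A] a(1) a'(1) P.Icarr[OF sq] by auto
  then show False
    using M.submodule_minus_mem_iff[OF K _ _ a'(2)] PA[OF sq a'(1)] a(2) by blast
qed

end

context RD_essential_maximal
begin

text \<open>Otherwise \<open>z = a x + b y\<close> spans an RD-pure simple submodule of \<open>M/Pz\<close>.\<close>

lemma lincomb_locally_divisible:
  fixes M :: "('r,'m) module" and j :: "'m \<Rightarrow> 't"
  assumes M: "module R M" and j: "inj_on j (carrier M)"
    and a: "a \<in> P" and b: "b \<in> P" and x: "x \<in> carrier M" and y: "y \<in> carrier M"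
  defines "z \<equiv> a \<odot>\<^bsub>M\<^esub> x \<oplus>\<^bsub>M\<^esub> b \<odot>\<^bsub>M\<^esub> y"
  shows "\<exists>r\<in>P. \<exists>t\<in>carrier R - P. \<exists>m\<in>carrier M. t \<odot>\<^bsub>M\<^esub> z = r \<odot>\<^bsub>M\<^esub> m"
proof (rule ccontr)
  interpret M: module R M by fact
  assume "\<not> ?thesis"
  then have indivisible: "t \<odot>\<^bsub>M\<^esub> z \<noteq> r \<odot>\<^bsub>M\<^esub> m"
    if "r \<in> P" "t \<in> carrier R - P" "m \<in> carrier M" for r t m
    using that by blast
  have z: "z \<in> carrier M" using P.Icarr a b x y by (simp add: z_def)
  let ?N = "(\<lambda>c. c \<odot>\<^bsub>M\<^esub> z) ` P" and ?A = "(\<lambda>c. c \<odot>\<^bsub>M\<^esub> z) ` carrier R"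
  have N: "submodule ?N R M" and A: "submodule ?A R M"
    by (rule M.submodule_ideal_smult[OF _ z]; rule P.is_ideal oneideal)+
  have "?N \<subseteq> ?A" using P.a_subset by blast
  then obtain K where K: "submodule K R M" and KA: "K \<inter> ?A = ?N"
    and pure: "RD_pure_modulo R M K ?A" and ess: "essential_modulo R M K ?A"
    using exists_essential_RD_pure_quotient[OF M A N _
        RD_pure_modulo_ideal_smult[OF M z indivisible] j]
    by blast
  have PA: "q \<odot>\<^bsub>M\<^esub> u \<in> K" if q: "q \<in> P" and u: "u \<in> ?A" for q u
  proof -
    obtain c where c: "c \<in> carrier R" "u = c \<odot>\<^bsub>M\<^esub> z" using u by blast
    then have "q \<odot>\<^bsub>M\<^esub> u = (q \<otimes> c) \<odot>\<^bsub>M\<^esub> z" using P.Icarr[OF q] z by (simp add: M.smult_assoc1)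
    then show ?thesis using P.I_r_closed[OF q c(1)] KA by blast
  qed
  have "z \<in> K"
    unfolding z_def using essential_RD_pure_semisimple[OF M K A pure ess PA] a b x y
    by (intro M.submoduleE(5)[OF K]) blast+
  moreover have "z = \<one> \<odot>\<^bsub>M\<^esub> z" using z by simp
  then have "z \<in> ?A" by (rule image_eqI) simp
  ultimately obtain q where q: "q \<in> P" "z = q \<odot>\<^bsub>M\<^esub> z" using KA by blast
  have "(\<one> \<ominus> q) \<odot>\<^bsub>M\<^esub> z = z \<ominus>\<^bsub>M\<^esub> q \<odot>\<^bsub>M\<^esub> z"
    using P.Icarr[OF q(1)] z by (simp add: M.smult_l_diff)
  also have "\<dots> = \<zero> \<odot>\<^bsub>M\<^esub> z" unfolding q(2)[symmetric] using z by (simp add: M.M.minus_eq M.M.r_neg)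
  finally show False using indivisible[OF P.zero_closed one_minus_notin_P[OF q(1)] z] by blast
qed

lemma exists_local_common_divisor:
  fixes j :: "'r \<times> 'r \<Rightarrow> 't"
  assumes j: "inj j" and a: "a \<in> P" and b: "b \<in> P"
  shows "\<exists>r\<in>P. locally_dvd r a \<and> locally_dvd r b"
proof -
  let ?M = "prod_module (self_module R) (self_module R)"
  have M: "module R ?M" by (rule module_prod_module[OF module_self_module module_self_module])
  have "inj_on j (carrier ?M)" using j by (rule inj_on_subset) simp
  then obtain r t m where r: "r \<in> P" and t: "t \<in> carrier R - P" and m: "m \<in> carrier ?M"
    and eq: "t \<odot>\<^bsub>?M\<^esub> (a \<odot>\<^bsub>?M\<^esub> (\<one>, \<zero>) \<oplus>\<^bsub>?M\<^esub> b \<odot>\<^bsub>?M\<^esub> (\<zero>, \<one>)) = r \<odot>\<^bsub>?M\<^esub> m"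
    using lincomb_locally_divisible[OF M _ a b, of j "(\<one>, \<zero>)" "(\<zero>, \<one>)"] by auto
  obtain u v where m: "m = (u, v)" "u \<in> carrier R" "v \<in> carrier R" using m by auto
  have "t \<otimes> a = r \<otimes> u" "t \<otimes> b = r \<otimes> v" using eq P.Icarr a b by (simp_all add: m(1))
  then show ?thesis using r t m by (blast intro: locally_dvdI)
qed

end

context cring_maximal
begin

lemma locally_dvd_of_mult_eq:
  assumes "x \<in> carrier R" "y \<in> carrier R" "t \<in> carrier R" "u \<in> carrier R - P" "t \<otimes> x = y \<otimes> u"
  shows "locally_dvd x y"
  using assms by (intro locally_dvdI[of u t]) (simp_all add: m_comm)

lemma proper_local_divisor:
  assumes x: "x \<in> P" and b: "b \<in> P" and ndvd: "\<not> locally_dvd x b"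
    and "\<exists>r\<in>P. locally_dvd r x \<and> locally_dvd r b"
  shows "\<exists>y\<in>P. \<exists>u\<in>P. \<exists>t\<in>carrier R - P. t \<otimes> x = y \<otimes> u"
proof -
  obtain y t u where y: "y \<in> P" "locally_dvd y b"
    and t: "t \<in> carrier R - P" and u: "u \<in> carrier R" and eq: "t \<otimes> x = y \<otimes> u"
    using assms(4) unfolding locally_dvd_def[where b = x] by blast
  have "u \<in> P"
  proof (rule ccontr)
    assume "u \<notin> P"
    then have "locally_dvd x y"
      using P.Icarr x y(1) t u eq by (intro locally_dvd_of_mult_eq[of _ _ t u]) simp_all
    then show False
      using locally_dvd_trans[OF P.Icarr[OF x] P.Icarr[OF y(1)] P.Icarr[OF b] _ y(2)] ndvd by simp
  qed
  then show ?thesis using y(1) t eq by blast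
qed

lemma local_divisor_chain:
  assumes f: "\<And>n. f n \<in> carrier R" and u: "\<And>n. u n \<in> carrier R"
    and t: "\<And>n. t n \<in> carrier R - P" and step: "\<And>n. t n \<otimes> f n = f (Suc n) \<otimes> u n"
  shows "\<exists>w\<in>carrier R - P. w \<otimes> f 0 = finprod R u {..<n} \<otimes> f n"
proof (induction n)
  case 0
  show ?case using f one_notin_P by (intro bexI[of _ \<one>]) auto
next
  case (Suc n)
  then obtain w where w: "w \<in> carrier R - P" "w \<otimes> f 0 = finprod R u {..<n} \<otimes> f n" by blast
  let ?r = "finprod R u {..<n}"
  have r: "?r \<in> carrier R" using u by (auto intro: finprod_closed)
  have tR: "t n \<in> carrier R" using t[of n] by blast
  have "(t n \<otimes> w) \<otimes> f 0 = t n \<otimes> (?r \<otimes> f n)"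
    using w t[of n] f[of 0] by (simp add: m_assoc flip: w(2))
  also have "\<dots> = ?r \<otimes> (t n \<otimes> f n)" using r tR f[of n] by (simp add: m_lcomm)
  also have "\<dots> = (?r \<otimes> u n) \<otimes> f (Suc n)"
    unfolding step using r f[of "Suc n"] u[of n] by (simp add: m_ac)
  also have "?r \<otimes> u n = finprod R u {..<Suc n}"
    using u r by (simp add: lessThan_Suc m_comm Pi_iff)
  finally show ?case using mult_notin_P[OF t w(1)] by blast
qed

text \<open>Without a local generator, P contains an infinite chain of proper local divisors of an
  element that is not locally zero, whose successive quotients contradict local T-nilpotence.\<close>

lemma exists_local_generator:
  assumes common: "\<And>a b. \<lbrakk>a \<in> P; b \<in> P\<rbrakk> \<Longrightarrow> \<exists>r\<in>P. locally_dvd r a \<and> locally_dvd r b"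
    and T_nilpotent: "\<And>u :: nat \<Rightarrow> 'r. (\<And>n. u n \<in> P) \<Longrightarrow>
        \<exists>n. \<exists>s\<in>carrier R - P. s \<otimes> finprod R u {..<n} = \<zero>"
  shows "\<exists>p\<in>P. \<forall>a\<in>P. locally_dvd p a"
proof (rule ccontr)
  assume "\<not> ?thesis"
  then have ndvd: "\<exists>b\<in>P. \<not> locally_dvd x b" if "x \<in> P" for x using that by blast
  have "\<exists>y\<in>P. \<exists>u\<in>P. \<exists>t\<in>carrier R - P. t \<otimes> x = y \<otimes> u" if x: "x \<in> P" for x
    using ndvd[OF x] proper_local_divisor[OF x _ _ common[OF x]] by blast
  then obtain Y U T where YUT: "\<And>x. x \<in> P \<Longrightarrow>
    Y x \<in> P \<and> U x \<in> P \<and> T x \<in> carrier R - P \<and> T x \<otimes> x = Y x \<otimes> U x"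
    by metis
  obtain a where a: "a \<in> P" "\<not> locally_dvd \<zero> a" using ndvd[OF P.zero_closed] by blast
  define f where "f n = (Y ^^ n) a" for n
  have f0: "f 0 = a" and fSuc: "f (Suc n) = Y (f n)" for n by (simp_all add: f_def)
  have f: "f n \<in> P" for n using a(1) YUT by (induction n) (simp_all add: f0 fSuc)
  note chain = YUT[OF f]
  obtain n s where s: "s \<in> carrier R - P" "s \<otimes> finprod R (\<lambda>n. U (f n)) {..<n} = \<zero>"
    using T_nilpotent[of "\<lambda>n. U (f n)"] chain by blast
  have "\<exists>w\<in>carrier R - P. w \<otimes> f 0 = finprod R (\<lambda>n. U (f n)) {..<n} \<otimes> f n"
    by (rule local_divisor_chain[where t = "\<lambda>n. T (f n)"])
      (use chain f P.Icarr in \<open>auto simp: fSuc\<close>)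
  then obtain w where w: "w \<in> carrier R - P" "w \<otimes> a = finprod R (\<lambda>n. U (f n)) {..<n} \<otimes> f n"
    unfolding f0 by blast
  have r: "finprod R (\<lambda>n. U (f n)) {..<n} \<in> carrier R"
    using chain P.Icarr by (intro finprod_closed) auto
  have "(s \<otimes> w) \<otimes> a = (s \<otimes> finprod R (\<lambda>n. U (f n)) {..<n}) \<otimes> f n"
    using s(1) w r P.Icarr[OF a(1)] P.Icarr[OF f] by (simp add: m_assoc)
  also have "\<dots> = \<zero> \<otimes> \<zero>" using s(2) P.Icarr[OF f] by simp
  finally show False using a(2) mult_notin_P[OF s(1) w(1)] locally_dvdI[OF _ zero_closed] by blast
qed

section \<open>Essential RD-pure extensions over a locally principal nilpotent maximal ideal\<close>

lemma mem_sum_of_smult_mem_sum: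
  assumes M: "module R M" and A: "submodule A R M" and K: "submodule K R M"
    and pure: "RD_pure_modulo R M K A" and ess: "essential_modulo R M K A"
    and cancel: "\<And>t m. \<lbrakk>t \<in> carrier R - P; m \<in> carrier M; t \<odot>\<^bsub>M\<^esub> m \<in> K\<rbrakk> \<Longrightarrow> m \<in> K"
    and p: "p \<in> P" "\<And>q. q \<in> P \<Longrightarrow> locally_dvd p q"
    and m: "m \<in> carrier M" and "\<exists>x\<in>A. p \<odot>\<^bsub>M\<^esub> m \<ominus>\<^bsub>M\<^esub> x \<in> K"
  shows "\<exists>x\<in>A. m \<ominus>\<^bsub>M\<^esub> x \<in> K"
proof -
  interpret M: module R M by fact
  have pR: "p \<in> carrier R" using P.Icarr[OF p(1)] .
  obtain x where x: "x \<in> A" "p \<odot>\<^bsub>M\<^esub> m \<ominus>\<^bsub>M\<^esub> x \<in> K" using assms(10) by blast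
  obtain a where a: "a \<in> A" "x \<ominus>\<^bsub>M\<^esub> p \<odot>\<^bsub>M\<^esub> a \<in> K"
    using RD_pure_moduloD[OF pure pR m x] .
  note closed = M.submodule_closed[OF A x(1)] M.submodule_closed[OF A a(1)]
  define y where "y = m \<ominus>\<^bsub>M\<^esub> a"
  have y: "y \<in> carrier M" using m closed by (simp add: y_def)
  have "(p \<odot>\<^bsub>M\<^esub> m \<ominus>\<^bsub>M\<^esub> x) \<oplus>\<^bsub>M\<^esub> (x \<ominus>\<^bsub>M\<^esub> p \<odot>\<^bsub>M\<^esub> a) = p \<odot>\<^bsub>M\<^esub> y"
    using pR m closed
    by (simp add: y_def M.M.minus_eq M.smult_r_distr M.smult_r_minus M.M.a_assoc M.M.r_neg1)
  then have py: "p \<odot>\<^bsub>M\<^esub> y \<in> K" using M.submoduleE(5)[OF K x(2) a(2)] by simp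
  have "q \<odot>\<^bsub>M\<^esub> y \<in> K" if q: "q \<in> P" for q
  proof -
    have qR: "q \<in> carrier R" using P.Icarr[OF q] .
    obtain t c where t: "t \<in> carrier R - P" and c: "c \<in> carrier R" "t \<otimes> q = p \<otimes> c"
      using p(2)[OF q] unfolding locally_dvd_def by blast
    have "t \<odot>\<^bsub>M\<^esub> (q \<odot>\<^bsub>M\<^esub> y) = (c \<otimes> p) \<odot>\<^bsub>M\<^esub> y"
      using t qR c pR y by (simp add: m_comm[of c p] flip: M.smult_assoc1)
    then have "t \<odot>\<^bsub>M\<^esub> (q \<odot>\<^bsub>M\<^esub> y) \<in> K"
      using M.submoduleE(4)[OF K c(1) py] c pR y by (simp add: M.smult_assoc1)
    then show ?thesis using cancel[OF t] qR y by simp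
  qed
  then obtain a' where a': "a' \<in> A" "y \<ominus>\<^bsub>M\<^esub> a' \<in> K"
    using essential_modulo_socle[OF M A K ess y] by blast
  then have "m \<ominus>\<^bsub>M\<^esub> (a \<oplus>\<^bsub>M\<^esub> a') \<in> K"
    using m closed M.submodule_closed[OF A a'(1)]
    by (simp add: y_def M.M.minus_eq M.M.minus_add M.M.a_assoc)
  then show ?thesis using M.submoduleE(5)[OF A a(1) a'(1)] by blast
qed

lemma essential_RD_pure_trivial:
  assumes M: "module R M" and A: "submodule A R M" and K: "submodule K R M"
    and pure: "RD_pure_modulo R M K A" and ess: "essential_modulo R M K A"
    and cancel: "\<And>t m. \<lbrakk>t \<in> carrier R - P; m \<in> carrier M; t \<odot>\<^bsub>M\<^esub> m \<in> K\<rbrakk> \<Longrightarrow> m \<in> K"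
    and p: "p \<in> P" "\<And>q. q \<in> P \<Longrightarrow> locally_dvd p q"
    and nilpotent: "s \<in> carrier R - P" "s \<otimes> p [^] (n::nat) = \<zero>"
    and m: "m \<in> carrier M"
  shows "\<exists>x\<in>A. m \<ominus>\<^bsub>M\<^esub> x \<in> K"
proof -
  interpret M: module R M by fact
  have pR: "p \<in> carrier R" using P.Icarr[OF p(1)] .
  have descend: "\<exists>x\<in>A. m \<ominus>\<^bsub>M\<^esub> x \<in> K" if "m \<in> carrier M" "p [^] k \<odot>\<^bsub>M\<^esub> m \<in> K" for k :: nat and m
    using that
  proof (induction k arbitrary: m)
    case 0
    then show ?case using M.submodule_zero_closed[OF A] by (intro bexI[of _ "\<zero>\<^bsub>M\<^esub>"]) simp_all
  next
    case (Suc k)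
    have "p [^] k \<odot>\<^bsub>M\<^esub> (p \<odot>\<^bsub>M\<^esub> m) \<in> K" using Suc.prems pR by (simp add: M.smult_assoc1)
    then have "\<exists>x\<in>A. p \<odot>\<^bsub>M\<^esub> m \<ominus>\<^bsub>M\<^esub> x \<in> K" using Suc pR by simp
    from mem_sum_of_smult_mem_sum[OF M A K pure ess _ p(1) _ Suc.prems(1) this]
    show ?case using cancel p(2) by blast
  qed
  have "s \<odot>\<^bsub>M\<^esub> (p [^] n \<odot>\<^bsub>M\<^esub> m) = (s \<otimes> p [^] n) \<odot>\<^bsub>M\<^esub> m"
    using nilpotent(1) pR m by (simp add: M.smult_assoc1)
  also have "\<dots> \<in> K" using nilpotent(2) m M.submodule_zero_closed[OF K] by simp
  finally have "p [^] n \<odot>\<^bsub>M\<^esub> m \<in> K" using cancel[OF nilpotent(1)] pR m by simp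
  then show ?thesis by (rule descend[OF m])
qed

end

context RD_essential_maximal
begin

lemma exists_nilpotent_local_generator:
  fixes \<iota> :: "(nat \<Rightarrow> 'r) \<Rightarrow> 't" and j :: "'r \<times> 'r \<Rightarrow> 't"
  assumes \<iota>: "inj \<iota>" and j: "inj j"
  obtains p n s where "p \<in> P" "\<And>a. a \<in> P \<Longrightarrow> locally_dvd p a"
    "s \<in> carrier R - P" "s \<otimes> p [^] (n::nat) = \<zero>"
proof -
  obtain p where p: "p \<in> P" "\<And>a. a \<in> P \<Longrightarrow> locally_dvd p a"
    using exists_local_generator[OF exists_local_common_divisor[OF j]
        locally_T_nilpotent[OF _ \<iota>]] by blast
  obtain n s where s: "s \<in> carrier R - P" "s \<otimes> finprod R (\<lambda>_. p) {..<n::nat} = \<zero>"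
    using locally_T_nilpotent[OF _ \<iota>, of "\<lambda>_. p"] p(1) by blast
  then have "s \<otimes> p [^] n = \<zero>" using P.Icarr[OF p(1)] by (simp add: finprod_const)
  then show thesis using that p s(1) by blast
qed

end

section \<open>Extending homomorphisms along RD-pure monomorphisms\<close>

text \<open>Up to a sign \<open>(B \<oplus> E)/graph\<close> is the pushout of f and g, and \<open>image_and_target\<close> is the preimage
  of E in \<open>B \<oplus> E\<close>.  A complement of E in the pushout is the graph of an extension of g along f.\<close>

locale module_pushout = f: module_homomorphism R A B f + g: module_homomorphism R A E g
  for R :: "('r,'c) ring_scheme" (structure) and A :: "('r,'a) module" and B :: "('r,'b) module"
    and E :: "('r,'e) module" and f g
begin

definition graph :: "('b \<times> 'e) set" where
  "graph = (\<lambda>a. (f a, g a)) ` carrier A"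

definition image_and_target :: "('b \<times> 'e) set" where
  "image_and_target = f ` carrier A \<times> carrier E"

sublocale BE: module R "prod_module B E"
  by (rule module_prod_module[OF f.N.module_axioms g.N.module_axioms])

lemma minus_pair:
  "\<lbrakk>b \<in> carrier B; e \<in> carrier E; b' \<in> carrier B; e' \<in> carrier E\<rbrakk>
    \<Longrightarrow> (b, e) \<ominus>\<^bsub>prod_module B E\<^esub> (b', e') = (b \<ominus>\<^bsub>B\<^esub> b', e \<ominus>\<^bsub>E\<^esub> e')"
  using prod_module_minus[OF f.N.module_axioms g.N.module_axioms] by simp

lemma submodule_graph: "submodule graph R (prod_module B E)"
proof -
  interpret fg: module_homomorphism R A "prod_module B E" "\<lambda>a. (f a, g a)"
    by unfold_locales (auto simp: module_hom_def)
  show ?thesis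
    unfolding graph_def by (rule fg.submodule_image[OF f.M.carrier_is_submodule])
qed

lemma submodule_image_and_target: "submodule image_and_target R (prod_module B E)"
proof -
  have image: "submodule (f ` carrier A) R B"
    by (rule f.submodule_image[OF f.M.carrier_is_submodule])
  note imageE = f.N.submoduleE[OF image] f.N.submodule_zero_closed[OF image]
  have "\<ominus>\<^bsub>prod_module B E\<^esub> x = (\<ominus>\<^bsub>R\<^esub> \<one>\<^bsub>R\<^esub>) \<odot>\<^bsub>prod_module B E\<^esub> x" if "x \<in> carrier (prod_module B E)" for x
    using BE.smult_l_minus[of \<one> x] that by (simp del: prod_module_simps)
  then show ?thesis
    using imageE(4-) by (intro BE.submoduleI) (auto simp: image_and_target_def)
qed

lemma graph_subset: "graph \<subseteq> image_and_target"
  by (auto simp: graph_def image_and_target_def)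

lemma RD_pure_modulo_graph:
  assumes "RD_pure R (f ` carrier A) B"
  shows "RD_pure_modulo R (prod_module B E) graph image_and_target"
  unfolding RD_pure_modulo_def
proof (intro ballI impI)
  have image: "submodule (f ` carrier A) R B"
    by (rule f.submodule_image[OF f.M.carrier_is_submodule])
  fix r m x
  assume r: "r \<in> carrier R" and m: "m \<in> carrier (prod_module B E)" and x: "x \<in> image_and_target"
    and rm: "r \<odot>\<^bsub>prod_module B E\<^esub> m \<ominus>\<^bsub>prod_module B E\<^esub> x \<in> graph"
  obtain b e where b: "m = (b, e)" "b \<in> carrier B" "e \<in> carrier E" using m by auto
  obtain a e' where a: "x = (f a, e')" "a \<in> carrier A" "e' \<in> carrier E"
    using x by (auto simp: image_and_target_def)
  have "r \<odot>\<^bsub>B\<^esub> b \<ominus>\<^bsub>B\<^esub> f a \<in> f ` carrier A"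
    using rm r a b by (auto simp: graph_def minus_pair)
  then have "r \<odot>\<^bsub>B\<^esub> b \<in> f ` carrier A"
    using f.N.submodule_minus_mem_iff[OF image, of "r \<odot>\<^bsub>B\<^esub> b" "f a"] r a b by simp
  then obtain a' where a': "a' \<in> carrier A" "r \<odot>\<^bsub>B\<^esub> b = r \<odot>\<^bsub>B\<^esub> f a'"
    using assms r b unfolding RD_pure_iff[OF f.N.module_axioms image] by blast
  have "x \<ominus>\<^bsub>prod_module B E\<^esub> r \<odot>\<^bsub>prod_module B E\<^esub> m \<in> graph"
    using BE.submodule_minus_commute[OF submodule_graph _ _ rm] r m
      BE.submodule_closed[OF submodule_image_and_target x] by blast
  then have "x \<ominus>\<^bsub>prod_module B E\<^esub> r \<odot>\<^bsub>prod_module B E\<^esub> (f a', e) \<in> graph"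
    using a'(2) b(1) by simp
  moreover have "(f a', e) \<in> image_and_target" using a'(1) b by (simp add: image_and_target_def)
  ultimately show "\<exists>a'\<in>image_and_target. x \<ominus>\<^bsub>prod_module B E\<^esub> r \<odot>\<^bsub>prod_module B E\<^esub> a' \<in> graph"
    by blast
qed

lemma graph_cancel_smult:
  assumes t: "t \<in> carrier R"
    and surj_A: "(\<lambda>a. t \<odot>\<^bsub>A\<^esub> a) ` carrier A = carrier A"
    and inj_B: "inj_on (\<lambda>b. t \<odot>\<^bsub>B\<^esub> b) (carrier B)" and inj_E: "inj_on (\<lambda>e. t \<odot>\<^bsub>E\<^esub> e) (carrier E)"
    and x: "x \<in> carrier (prod_module B E)" "t \<odot>\<^bsub>prod_module B E\<^esub> x \<in> graph"
  shows "x \<in> graph"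
proof -
  obtain b e where be: "x = (b, e)" "b \<in> carrier B" "e \<in> carrier E" using x(1) by auto
  obtain a where a: "a \<in> carrier A" "t \<odot>\<^bsub>B\<^esub> b = f a" "t \<odot>\<^bsub>E\<^esub> e = g a"
    using x(2) by (auto simp: be(1) graph_def)
  obtain a' where a': "a' \<in> carrier A" "a = t \<odot>\<^bsub>A\<^esub> a'"
    using a(1) surj_A by blast
  have "b = f a'" using inj_onD[OF inj_B, of b "f a'"] a a' t be by simp
  moreover have "e = g a'" using inj_onD[OF inj_E, of e "g a'"] a a' t be by simp
  ultimately show ?thesis using a'(1) by (simp add: be(1) graph_def)
qed

lemma complement_cancel_smult:
  assumes K: "submodule K R (prod_module B E)" and disjoint: "K \<inter> image_and_target = graph"
    and ess: "essential_modulo R (prod_module B E) K image_and_target"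
    and A: "bij_betw (\<lambda>a. t \<odot>\<^bsub>A\<^esub> a) (carrier A) (carrier A)"
    and B: "bij_betw (\<lambda>b. t \<odot>\<^bsub>B\<^esub> b) (carrier B) (carrier B)"
    and E: "bij_betw (\<lambda>e. t \<odot>\<^bsub>E\<^esub> e) (carrier E) (carrier E)"
    and t: "t \<in> carrier R"
    and m: "m \<in> carrier (prod_module B E)" "t \<odot>\<^bsub>prod_module B E\<^esub> m \<in> K"
  shows "m \<in> K"
proof (rule essential_modulo_cancel_smult[OF BE.module_axioms submodule_image_and_target K ess _ t m])
  fix x assume x: "x \<in> image_and_target" "t \<odot>\<^bsub>prod_module B E\<^esub> x \<in> K"
  then have "t \<odot>\<^bsub>prod_module B E\<^esub> x \<in> graph"
    using BE.submoduleE(4)[OF submodule_image_and_target] t disjoint by blast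
  then have "x \<in> graph"
    using graph_cancel_smult[OF t bij_betw_imp_surj_on[OF A] B[THEN bij_betw_imp_inj_on]
        E[THEN bij_betw_imp_inj_on]] BE.submodule_closed[OF submodule_image_and_target x(1)]
    by blast
  then show "x \<in> K" using disjoint by blast
qed

context
  fixes K
  assumes f_inj: "inj_on f (carrier A)" and K: "submodule K R (prod_module B E)"
    and disjoint: "K \<inter> image_and_target = graph"
    and sum: "\<And>m. m \<in> carrier (prod_module B E) \<Longrightarrow> \<exists>x\<in>image_and_target. m \<ominus>\<^bsub>prod_module B E\<^esub> x \<in> K"
begin

lemma complement_total:
  assumes b: "b \<in> carrier B"
  shows "\<exists>e\<in>carrier E. (b, e) \<in> K"
proof -
  obtain a e where a: "a \<in> carrier A" and e: "e \<in> carrier E"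
    and diff: "(b \<ominus>\<^bsub>B\<^esub> f a, \<zero>\<^bsub>E\<^esub> \<ominus>\<^bsub>E\<^esub> e) \<in> K"
    using sum[of "(b, \<zero>\<^bsub>E\<^esub>)"] b by (auto simp: image_and_target_def minus_pair)
  have "(f a, g a) \<in> K" using a disjoint by (auto simp: graph_def)
  from BE.submoduleE(5)[OF K diff this] have "(b, (\<zero>\<^bsub>E\<^esub> \<ominus>\<^bsub>E\<^esub> e) \<oplus>\<^bsub>E\<^esub> g a) \<in> K"
    using a b by (simp add: f.N.M.minus_eq f.N.M.a_assoc f.N.M.l_neg)
  then show ?thesis by (rule bexI) (use a e in simp)
qed

lemma complement_functional:
  assumes "(b, e) \<in> K" "(b, e') \<in> K"
  shows "e = e'"
proof -
  have closed: "b \<in> carrier B" "e \<in> carrier E" "e' \<in> carrier E"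
    using BE.submodule_closed[OF K] assms by auto
  have "(\<zero>\<^bsub>B\<^esub>, e \<ominus>\<^bsub>E\<^esub> e') \<in> K"
    using BE.submodule_minus_closed[OF K assms] closed
    by (simp add: minus_pair f.N.M.minus_eq f.N.M.r_neg)
  moreover have "\<zero>\<^bsub>B\<^esub> \<in> f ` carrier A" by (rule image_eqI[of _ _ "\<zero>\<^bsub>A\<^esub>"]) simp_all
  ultimately have "(\<zero>\<^bsub>B\<^esub>, e \<ominus>\<^bsub>E\<^esub> e') \<in> graph"
    using closed disjoint by (auto simp: image_and_target_def)
  then obtain a where a: "a \<in> carrier A" "f a = \<zero>\<^bsub>B\<^esub>" "e \<ominus>\<^bsub>E\<^esub> e' = g a" by (auto simp: graph_def)
  have "a = \<zero>\<^bsub>A\<^esub>" using inj_onD[OF f_inj, of a "\<zero>\<^bsub>A\<^esub>"] a by simp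
  then have "e \<oplus>\<^bsub>E\<^esub> \<ominus>\<^bsub>E\<^esub> e' = \<zero>\<^bsub>E\<^esub>" using a(3) by (simp add: g.N.M.minus_eq)
  then show ?thesis using closed g.N.M.add.inv_solve_right'[of "\<zero>\<^bsub>E\<^esub>" e e'] by simp
qed

lemma exists_extension_of_complement: "\<exists>h\<in>module_hom R B E. \<forall>a\<in>carrier A. h (f a) = g a"
proof -
  obtain h where h: "\<And>b. b \<in> carrier B \<Longrightarrow> h b \<in> carrier E \<and> (b, h b) \<in> K"
    using complement_total by metis
  have h_eq: "h b = e" if "(b, e) \<in> K" for b e
    using complement_functional[OF _ that] h BE.submodule_closed[OF K that] by auto
  have "h \<in> module_hom R B E"
    unfolding module_hom_def
  proof (intro CollectI conjI ballI)
    show "h \<in> carrier B \<rightarrow> carrier E" using h by blast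
    show "h (x \<oplus>\<^bsub>B\<^esub> y) = h x \<oplus>\<^bsub>E\<^esub> h y" if "x \<in> carrier B" "y \<in> carrier B" for x y
      using BE.submoduleE(5)[OF K, of "(x, h x)" "(y, h y)"] h that by (intro h_eq) simp
    show "h (c \<odot>\<^bsub>B\<^esub> x) = c \<odot>\<^bsub>E\<^esub> h x" if "c \<in> carrier R" "x \<in> carrier B" for c x
      using BE.submoduleE(4)[OF K that(1), of "(x, h x)"] h that by (intro h_eq) simp
  qed
  moreover have "h (f a) = g a" if "a \<in> carrier A" for a
    using that disjoint by (intro h_eq) (auto simp: graph_def)
  ultimately show ?thesis by blast
qed

end

end

section \<open>Localization\<close>

definition restrict_scalars :: "('r \<Rightarrow> 'l) \<Rightarrow> ('l,'v) module \<Rightarrow> ('r,'v) module" where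
  "restrict_scalars \<phi> V = \<lparr>carrier = carrier V, mult = mult V, one = one V, zero = zero V,
     add = add V, smult = (\<lambda>c x. \<phi> c \<odot>\<^bsub>V\<^esub> x)\<rparr>"

lemma restrict_scalars_simps [simp]:
  "carrier (restrict_scalars \<phi> V) = carrier V" "\<zero>\<^bsub>restrict_scalars \<phi> V\<^esub> = \<zero>\<^bsub>V\<^esub>"
  "x \<oplus>\<^bsub>restrict_scalars \<phi> V\<^esub> y = x \<oplus>\<^bsub>V\<^esub> y" "c \<odot>\<^bsub>restrict_scalars \<phi> V\<^esub> x = \<phi> c \<odot>\<^bsub>V\<^esub> x"
  by (simp_all add: restrict_scalars_def)

locale localization_hom = cring R
  for R :: "('r,'c) ring_scheme" (structure) and L :: "('l,'d) ring_scheme" and \<phi> S +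
  assumes hom: "\<phi> \<in> ring_hom R L" and denominators_closed: "S \<subseteq> carrier R"
    and denominator_invertible: "s \<in> S \<Longrightarrow> \<exists>u\<in>carrier L. u \<otimes>\<^bsub>L\<^esub> \<phi> s = \<one>\<^bsub>L\<^esub>"
    and fraction: "x \<in> carrier L \<Longrightarrow> \<exists>s\<in>S. \<exists>c\<in>carrier R. \<phi> s \<otimes>\<^bsub>L\<^esub> x = \<phi> c"
begin

lemma image_closed [simp]: "c \<in> carrier R \<Longrightarrow> \<phi> c \<in> carrier L"
  by (rule ring_hom_closed[OF hom])

lemma module_restrict_scalars:
  assumes "module L V"
  shows "module R (restrict_scalars \<phi> V)"
proof -
  interpret V: module L V by fact
  show ?thesis
  proof (rule moduleI[OF is_cring])
    show "abelian_group (restrict_scalars \<phi> V)"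
      by (rule abelian_groupI) (auto simp: V.M.a_ac intro: V.M.l_neg bexI[of _ "\<ominus>\<^bsub>V\<^esub> _"])
  qed (use hom in \<open>auto simp: ring_hom_add ring_hom_mult ring_hom_one V.smult_l_distr
      V.smult_r_distr V.smult_assoc1\<close>)
qed

lemma bij_betw_smult_denominator:
  assumes V: "module L V" and s: "s \<in> S"
  shows "bij_betw (\<lambda>x. \<phi> s \<odot>\<^bsub>V\<^esub> x) (carrier V) (carrier V)"
proof -
  interpret V: module L V by fact
  have \<phi>s: "\<phi> s \<in> carrier L" using s denominators_closed by auto
  obtain u where u: "u \<in> carrier L" "u \<otimes>\<^bsub>L\<^esub> \<phi> s = \<one>\<^bsub>L\<^esub>" using denominator_invertible[OF s] by blast
  show ?thesis
    by (rule bij_betw_byWitness[where f' = "\<lambda>x. u \<odot>\<^bsub>V\<^esub> x"])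
      (use u \<phi>s in \<open>auto simp: V.R.m_comm[of "\<phi> s" u] simp flip: V.smult_assoc1\<close>)
qed

lemma module_hom_restrict_scalars:
  "f \<in> module_hom L V W \<Longrightarrow> f \<in> module_hom R (restrict_scalars \<phi> V) (restrict_scalars \<phi> W)"
  by (auto simp: module_hom_def)

lemma module_hom_of_restrict_scalars:
  assumes V: "module L V" and W: "module L W"
    and h: "h \<in> module_hom R (restrict_scalars \<phi> V) (restrict_scalars \<phi> W)"
  shows "h \<in> module_hom L V W"
proof -
  interpret V: module L V by fact
  interpret W: module L W by fact
  have h_closed: "h x \<in> carrier W" and h_smult: "c \<in> carrier R \<Longrightarrow> h (\<phi> c \<odot>\<^bsub>V\<^esub> x) = \<phi> c \<odot>\<^bsub>W\<^esub> h x"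
    if "x \<in> carrier V" for c x
    using h that by (auto simp: module_hom_def)
  have "h (l \<odot>\<^bsub>V\<^esub> x) = l \<odot>\<^bsub>W\<^esub> h x" if l: "l \<in> carrier L" and x: "x \<in> carrier V" for l x
  proof -
    obtain s c where s: "s \<in> S" and c: "c \<in> carrier R" "\<phi> s \<otimes>\<^bsub>L\<^esub> l = \<phi> c"
      using fraction[OF l] by blast
    have sR: "s \<in> carrier R" using s denominators_closed by auto
    have "\<phi> s \<odot>\<^bsub>W\<^esub> h (l \<odot>\<^bsub>V\<^esub> x) = h (\<phi> c \<odot>\<^bsub>V\<^esub> x)"
      using h_smult[of "l \<odot>\<^bsub>V\<^esub> x" s] sR l x by (simp flip: c(2) V.smult_assoc1)
    also have "\<dots> = \<phi> s \<odot>\<^bsub>W\<^esub> (l \<odot>\<^bsub>W\<^esub> h x)"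
      using h_smult[OF x c(1)] h_closed[OF x] sR l by (simp flip: c(2) add: W.smult_assoc1)
    finally show ?thesis
      using inj_onD[OF bij_betw_imp_inj_on[OF bij_betw_smult_denominator[OF W s]]]
          h_closed l x by simp
  qed
  then show ?thesis using h by (auto simp: module_hom_def)
qed

end

locale cring_submonoid = cring R + submonoid S R for R :: "('r,'c) ring_scheme" (structure) and S
begin

lemma loc_eqI:
  assumes "a \<in> carrier R" "b \<in> carrier R" "s \<in> S" "t \<in> S" "u \<in> S" "u \<otimes> (a \<otimes> t \<ominus> b \<otimes> s) = \<zero>"
  shows "((a, s), (b, t)) \<in> loc_eq R S"
  using assms unfolding loc_eq_def by blast

lemma loc_eqE:
  assumes "(x, y) \<in> loc_eq R S"
  obtains a s b t u where "x = (a, s)" "y = (b, t)" "a \<in> carrier R" "b \<in> carrier R"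
    "s \<in> S" "t \<in> S" "u \<in> S" "u \<otimes> (a \<otimes> t \<ominus> b \<otimes> s) = \<zero>"
  using assms unfolding loc_eq_def by blast

lemma equiv_loc_eq: "equiv (carrier R \<times> S) (loc_eq R S)"
proof (rule equivI)
  show "loc_eq R S \<subseteq> (carrier R \<times> S) \<times> (carrier R \<times> S)" by (auto simp: loc_eq_def)
  show "refl_on (carrier R \<times> S) (loc_eq R S)"
    by (auto simp: refl_on_def minus_eq r_neg intro!: loc_eqI[where u = \<one>])
  show "sym (loc_eq R S)"
  proof (rule symI)
    fix x y assume "(x, y) \<in> loc_eq R S"
    then obtain a s b t u where xy: "x = (a, s)" "y = (b, t)"
      and ab: "a \<in> carrier R" "b \<in> carrier R"
      and stu: "s \<in> S" "t \<in> S" "u \<in> S" and zero: "u \<otimes> (a \<otimes> t \<ominus> b \<otimes> s) = \<zero>"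
      by (rule loc_eqE)
    note carrier = stu[THEN mem_carrier]
    have "u \<otimes> (b \<otimes> s \<ominus> a \<otimes> t) = \<ominus> (u \<otimes> (a \<otimes> t \<ominus> b \<otimes> s))" using ab carrier by algebra
    then show "(y, x) \<in> loc_eq R S" using xy ab stu zero by (auto intro!: loc_eqI[where u = u])
  qed
  show "trans (loc_eq R S)"
  proof (rule transI)
    fix x y z assume "(x, y) \<in> loc_eq R S" "(y, z) \<in> loc_eq R S"
    then obtain a s b t u c w v where xyz: "x = (a, s)" "z = (c, w)"
      and abc: "a \<in> carrier R" "b \<in> carrier R" "c \<in> carrier R"
      and stw: "s \<in> S" "t \<in> S" "w \<in> S" and uv: "u \<in> S" "v \<in> S"
      and zero: "u \<otimes> (a \<otimes> t \<ominus> b \<otimes> s) = \<zero>" "v \<otimes> (b \<otimes> w \<ominus> c \<otimes> t) = \<zero>"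
      by (auto elim!: loc_eqE)
    note carrier = stw[THEN mem_carrier] uv[THEN mem_carrier]
    have "(u \<otimes> (v \<otimes> t)) \<otimes> (a \<otimes> w \<ominus> c \<otimes> s) =
      (v \<otimes> w) \<otimes> (u \<otimes> (a \<otimes> t \<ominus> b \<otimes> s)) \<oplus> (u \<otimes> s) \<otimes> (v \<otimes> (b \<otimes> w \<ominus> c \<otimes> t))"
      using abc carrier by algebra
    also have "\<dots> = \<zero>" using zero carrier by simp
    finally show "(x, z) \<in> loc_eq R S"
      unfolding xyz using abc stw uv by (intro loc_eqI[where u = "u \<otimes> (v \<otimes> t)"]) auto
  qed
qed

lemma frac_eqI:
  assumes "a \<in> carrier R" "b \<in> carrier R" "s \<in> S" "t \<in> S" "u \<in> S" "u \<otimes> (a \<otimes> t \<ominus> b \<otimes> s) = \<zero>"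
  shows "frac R S a s = frac R S b t"
  unfolding frac_def using equiv_class_eq[OF equiv_loc_eq loc_eqI[OF assms]] .

lemma some_mem_frac:
  assumes "a \<in> carrier R" "s \<in> S"
  obtains a' s' u where "(SOME p. p \<in> frac R S a s) = (a', s')" "a' \<in> carrier R" "s' \<in> S" "u \<in> S"
    "u \<otimes> (a \<otimes> s' \<ominus> a' \<otimes> s) = \<zero>"
proof -
  have "(a, s) \<in> frac R S a s"
    unfolding frac_def using equiv_class_self[OF equiv_loc_eq] assms by blast
  then have "(SOME p. p \<in> frac R S a s) \<in> frac R S a s" by (rule someI)
  then have "((a, s), SOME p. p \<in> frac R S a s) \<in> loc_eq R S" by (simp add: frac_def)
  then show thesis by (rule loc_eqE) (use that in auto)
qed

lemma frac_mult:
  assumes ab: "a \<in> carrier R" "b \<in> carrier R" and st: "s \<in> S" "t \<in> S"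
  shows "frac R S a s \<otimes>\<^bsub>localization R S\<^esub> frac R S b t = frac R S (a \<otimes> b) (s \<otimes> t)"
proof -
  obtain a' s' u where a': "(SOME p. p \<in> frac R S a s) = (a', s')" "a' \<in> carrier R" "s' \<in> S" "u \<in> S"
    "u \<otimes> (a \<otimes> s' \<ominus> a' \<otimes> s) = \<zero>" using some_mem_frac[OF ab(1) st(1)] .
  obtain b' t' v where b': "(SOME p. p \<in> frac R S b t) = (b', t')" "b' \<in> carrier R" "t' \<in> S" "v \<in> S"
    "v \<otimes> (b \<otimes> t' \<ominus> b' \<otimes> t) = \<zero>" using some_mem_frac[OF ab(2) st(2)] .
  note carrier = st[THEN mem_carrier] a'(3,4)[THEN mem_carrier] b'(3,4)[THEN mem_carrier]
  have "(u \<otimes> v) \<otimes> ((a' \<otimes> b') \<otimes> (s \<otimes> t) \<ominus> (a \<otimes> b) \<otimes> (s' \<otimes> t')) =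
    \<ominus> ((v \<otimes> (b \<otimes> t')) \<otimes> (u \<otimes> (a \<otimes> s' \<ominus> a' \<otimes> s)) \<oplus> (u \<otimes> (a' \<otimes> s)) \<otimes> (v \<otimes> (b \<otimes> t' \<ominus> b' \<otimes> t)))"
    using ab a'(2) b'(2) carrier by algebra
  also have "\<dots> = \<zero>" using a' b' ab carrier by simp
  finally have "frac R S (a' \<otimes> b') (s' \<otimes> t') = frac R S (a \<otimes> b) (s \<otimes> t)"
    using a' b' ab st by (intro frac_eqI[where u = "u \<otimes> v"]) auto
  then show ?thesis by (simp add: localization_def a'(1) b'(1))
qed

lemma frac_add:
  assumes ab: "a \<in> carrier R" "b \<in> carrier R" and st: "s \<in> S" "t \<in> S"
  shows "frac R S a s \<oplus>\<^bsub>localization R S\<^esub> frac R S b t = frac R S (a \<otimes> t \<oplus> b \<otimes> s) (s \<otimes> t)"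
proof -
  obtain a' s' u where a': "(SOME p. p \<in> frac R S a s) = (a', s')" "a' \<in> carrier R" "s' \<in> S" "u \<in> S"
    "u \<otimes> (a \<otimes> s' \<ominus> a' \<otimes> s) = \<zero>" using some_mem_frac[OF ab(1) st(1)] .
  obtain b' t' v where b': "(SOME p. p \<in> frac R S b t) = (b', t')" "b' \<in> carrier R" "t' \<in> S" "v \<in> S"
    "v \<otimes> (b \<otimes> t' \<ominus> b' \<otimes> t) = \<zero>" using some_mem_frac[OF ab(2) st(2)] .
  note carrier = st[THEN mem_carrier] a'(3,4)[THEN mem_carrier] b'(3,4)[THEN mem_carrier]
  have "(u \<otimes> v) \<otimes> ((a' \<otimes> t' \<oplus> b' \<otimes> s') \<otimes> (s \<otimes> t) \<ominus> (a \<otimes> t \<oplus> b \<otimes> s) \<otimes> (s' \<otimes> t')) =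
    \<ominus> ((v \<otimes> (t \<otimes> t')) \<otimes> (u \<otimes> (a \<otimes> s' \<ominus> a' \<otimes> s)) \<oplus> (u \<otimes> (s \<otimes> s')) \<otimes> (v \<otimes> (b \<otimes> t' \<ominus> b' \<otimes> t)))"
    using ab a'(2) b'(2) carrier by algebra
  also have "\<dots> = \<zero>" using a' b' ab carrier by simp
  finally have "frac R S (a' \<otimes> t' \<oplus> b' \<otimes> s') (s' \<otimes> t') = frac R S (a \<otimes> t \<oplus> b \<otimes> s) (s \<otimes> t)"
    using a' b' ab st carrier by (intro frac_eqI[where u = "u \<otimes> v"]) auto
  then show ?thesis by (simp add: localization_def a'(1) b'(1))
qed

lemma localization_hom_frac: "localization_hom R (localization R S) (\<lambda>a. frac R S a \<one>) S"
proof
  let ?L = "localization R S"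
  have carrier: "frac R S a s \<in> carrier ?L" if "a \<in> carrier R" "s \<in> S" for a s
    using that by (auto simp: localization_def)
  have one: "\<one>\<^bsub>?L\<^esub> = frac R S \<one> \<one>" by (simp add: localization_def)
  show "(\<lambda>a. frac R S a \<one>) \<in> ring_hom R ?L"
    by (rule ring_hom_memI) (simp_all add: carrier one frac_mult frac_add)
  show "S \<subseteq> carrier R" by (rule subset)
  have cancel: "frac R S c \<one> = frac R S (s \<otimes> c) s" if "s \<in> S" "c \<in> carrier R" for s c
    using that by (intro frac_eqI[where u = \<one>]) (auto simp: m_comm minus_eq r_neg)
  show "\<exists>x\<in>carrier ?L. x \<otimes>\<^bsub>?L\<^esub> frac R S s \<one> = \<one>\<^bsub>?L\<^esub>" if s: "s \<in> S" for s
    using cancel[OF s one_closed[THEN mem_carrier]] s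
    by (intro bexI[of _ "frac R S \<one> s"]) (simp_all add: frac_mult one carrier)
  show "\<exists>s\<in>S. \<exists>c\<in>carrier R. frac R S s \<one> \<otimes>\<^bsub>?L\<^esub> x = frac R S c \<one>" if x: "x \<in> carrier ?L" for x
  proof -
    obtain c s where c: "x = frac R S c s" "c \<in> carrier R" "s \<in> S"
      using x by (auto simp: localization_def)
    then have "frac R S s \<one> \<otimes>\<^bsub>?L\<^esub> x = frac R S c \<one>" using cancel[OF c(3,2)] by (simp add: frac_mult)
    then show ?thesis using c by blast
  qed
qed

end

context cring_maximal
begin

lemma cring_submonoid_compl: "cring_submonoid R (carrier R - P)"
  using one_notin_P mult_notin_P
  by (intro cring_submonoid.intro is_cring submonoid.intro) auto

definition local_module :: "('r,'v) module \<Rightarrow> bool" where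
  "local_module V \<longleftrightarrow> module R V \<and>
     (\<forall>t\<in>carrier R - P. bij_betw (\<lambda>x. t \<odot>\<^bsub>V\<^esub> x) (carrier V) (carrier V))"

end

context RD_essential_maximal
begin

lemma RD_pure_hom_extension:
  fixes A :: "('r,'a) module" and B :: "('r,'b) module" and E :: "('r,'e) module"
    and \<iota> :: "(nat \<Rightarrow> 'r) \<Rightarrow> 't" and j :: "'r \<times> 'r \<Rightarrow> 't" and k :: "'b \<times> 'e \<Rightarrow> 't"
  assumes \<iota>: "inj \<iota>" and j: "inj j" and k: "inj k"
    and A: "local_module A" and B: "local_module B" and E: "local_module E"
    and f: "f \<in> module_hom R A B" "inj_on f (carrier A)" and pure: "RD_pure R (f ` carrier A) B"
    and g: "g \<in> module_hom R A E"
  shows "\<exists>h\<in>module_hom R B E. \<forall>a\<in>carrier A. h (f a) = g a"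
proof -
  interpret module_pushout R A B E f g
    using A B E f(1) g unfolding local_module_def
    by (intro module_pushout.intro module_homomorphism.intro module_homomorphism_axioms.intro)
      blast+
  let ?M = "prod_module B E"
  obtain p n s where p: "p \<in> P" "\<And>a. a \<in> P \<Longrightarrow> locally_dvd p a"
    and nilpotent: "s \<in> carrier R - P" "s \<otimes> p [^] (n::nat) = \<zero>"
    using exists_nilpotent_local_generator[OF \<iota> j] by metis
  obtain K where K: "submodule K R ?M" and disjoint: "K \<inter> image_and_target = graph"
    and pure_K: "RD_pure_modulo R ?M K image_and_target"
    and ess: "essential_modulo R ?M K image_and_target"
    using exists_essential_RD_pure_quotient[OF BE.module_axioms
        submodule_image_and_target submodule_graph
        graph_subset RD_pure_modulo_graph[OF pure] inj_on_subset[OF k subset_UNIV]] .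
  have cancel: "m \<in> K"
    if t: "t \<in> carrier R - P" and m: "m \<in> carrier ?M" "t \<odot>\<^bsub>?M\<^esub> m \<in> K" for t m
    using complement_cancel_smult[OF K disjoint ess _ _ _ _ m] A B E t
    unfolding local_module_def by blast
  show ?thesis
    by (rule exists_extension_of_complement[OF f(2) K disjoint],
        rule essential_RD_pure_trivial[OF BE.module_axioms submodule_image_and_target K pure_K ess
          cancel p nilpotent])
qed

lemma pure_injective_of_localization_hom:
  fixes E :: "('l,'e) module" and A :: "('l,'a) module" and B :: "('l,'b) module"
    and \<iota> :: "(nat \<Rightarrow> 'r) \<Rightarrow> 't" and j :: "'r \<times> 'r \<Rightarrow> 't" and k :: "'b \<times> 'e \<Rightarrow> 't"
  assumes \<iota>: "inj \<iota>" and j: "inj j" and k: "inj k"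
    and \<phi>: "localization_hom R L \<phi> (carrier R - P)"
  shows "pure_injective_along L E A B f"
  unfolding pure_injective_along_def
proof (intro impI ballI)
  interpret \<phi>: localization_hom R L \<phi> "carrier R - P" by (rule \<phi>)
  fix g assume "module L E \<and> module L A \<and> module L B \<and> pure_mono L A B f"
    and g: "g \<in> module_hom L A E"
  then have E: "module L E" and A: "module L A" and B: "module L B"
    and f: "f \<in> module_hom L A B" "inj_on f (carrier A)" and f_pure: "pure_sub L (f ` carrier A) B"
    by (auto simp: pure_mono_def)
  interpret f: module_homomorphism L A B f
    by (intro module_homomorphism.intro module_homomorphism_axioms.intro A B f(1))
  let ?res = "restrict_scalars \<phi>"
  have local: "local_module (?res V)" if "module L V" for V :: "('l,'v) module"
    using \<phi>.module_restrict_scalars[OF that] \<phi>.bij_betw_smult_denominator[OF that]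
    by (simp add: local_module_def)
  have image: "submodule (f ` carrier A) L B"
    by (rule f.submodule_image[OF f.M.carrier_is_submodule])
  have f_res: "f \<in> module_hom R (?res A) (?res B)" by (rule \<phi>.module_hom_restrict_scalars[OF f(1)])
  interpret f_res: module_homomorphism R "?res A" "?res B" f
    by (intro module_homomorphism.intro module_homomorphism_axioms.intro
        \<phi>.module_restrict_scalars A B f_res)
  have image_res: "submodule (f ` carrier A) R (?res B)"
    using f_res.submodule_image[OF f_res.M.carrier_is_submodule] by simp
  have "RD_pure R (f ` carrier A) (?res B)"
    using pure_sub_imp_RD_pure[OF B image f_pure]
    unfolding RD_pure_iff[OF B image] RD_pure_iff[OF f_res.N.module_axioms image_res] by simp
  then obtain h where "h \<in> module_hom R (?res B) (?res E)" "\<forall>a\<in>carrier A. h (f a) = g a"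
    using RD_pure_hom_extension[OF \<iota> j k local[OF A] local[OF B] local[OF E] f_res]
      f(2) \<phi>.module_hom_restrict_scalars[OF g] by auto
  then show "\<exists>h\<in>module_hom L B E. \<forall>a\<in>carrier A. h (f a) = g a"
    using \<phi>.module_hom_of_restrict_scalars[OF B E] by blast
qed

end

lemma inj_range_map_upt: "inj (\<lambda>f. range (\<lambda>n. map f [0..<n]))"
proof (rule injI, rule ext)
  fix f g :: "nat \<Rightarrow> 'a" and i
  assume "range (\<lambda>n. map f [0..<n]) = range (\<lambda>n. map g [0..<n])"
  then obtain n where n: "map f [0..<Suc i] = map g [0..<n]" by blast
  then have "length (map f [0..<Suc i]) = length (map g [0..<n])" by (rule arg_cong)
  then show "f i = g i" using n by simp
qed

theorem theorem3p4:
  fixes R :: "'r ring" and P :: "'r set"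
  assumes cring: "cring R"
    and hyp: "\<forall>(B :: ('r, ('r + 'e + 'a + 'b) list set set) module) A.
                module R B \<and> submodule A R B \<and> RD_essential R A B \<longrightarrow> essential R A B"
    and max: "maximalideal P R"
  shows "\<forall>(E :: (('r \<times> 'r) set, 'e) module) (A :: (('r \<times> 'r) set, 'a) module)
            (B :: (('r \<times> 'r) set, 'b) module) f.
           pure_injective_along (localize_at R P) E A B f"
proof (intro allI)
  fix E :: "(('r \<times> 'r) set, 'e) module" and A :: "(('r \<times> 'r) set, 'a) module"
    and B :: "(('r \<times> 'r) set, 'b) module" and f
  interpret RD_essential_maximal R P "TYPE(('r + 'e + 'a + 'b) list set)"
    using hyp by (intro RD_essential_maximal.intro cring_maximal.intro RD_essential_cring.intro
        RD_essential_cring_axioms.intro cring max) blast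
  let ?\<iota> = "\<lambda>f. range (\<lambda>n. map (Inl \<circ> f) [0..<n]) :: ('r + 'e + 'a + 'b) list set"
  let ?j = "\<lambda>(x, y). {[Inl x, Inl y]} :: ('r + 'e + 'a + 'b) list set"
  let ?k = "\<lambda>(b, e). {[Inr (Inr (Inr b)), Inr (Inl e)]} :: ('r + 'e + 'a + 'b) list set"
  have "inj ?\<iota>"
    using inj_compose[OF inj_range_map_upt fun.inj_map[OF inj_Inl]] by (simp add: comp_def)
  moreover have "inj ?j" "inj ?k" by (auto intro!: injI)
  moreover have "localization_hom R (localize_at R P)
      (\<lambda>a. frac R (carrier R - P) a \<one>\<^bsub>R\<^esub>) (carrier R - P)"
    unfolding localize_at_def
    by (rule cring_submonoid.localization_hom_frac[OF cring_submonoid_compl])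
  ultimately show "pure_injective_along (localize_at R P) E A B f"
    by (rule pure_injective_of_localization_hom)
qed

end
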